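(* Let $F$ be a non-archimedean local field, $\mathcal G$ a quasi-reductive $F$-group, $G=\mathcal G(F)$, and let $\mathcal S$ be a maximal $F$-split torus of $\mathcal G$. Then $G$ has arbitrarily small compact open subgroups $K$ (i.e. every neighborhood of $1$ in $G$ contains such a $K$) that admit an Iwahori decomposition with respect to $\mathcal S$: for every pair of opposite pseudo-parabolic $F$-subgroups $P=MU$, $\bar P=M\bar U$ of $G$ containing $Z_G(S)$, the multiplication map $$(K\cap U)\times(K\cap M)\times(K\cap\bar U)\to K$$ is bijective.
   Context: Linear algebraic groups are smooth and affine. A connected linear algebraic $F$-group is quasi-reductive over $F$ if its largest smooth connected normal $F$-split unipotent $F$-subgroup is trivial. $G=\mathcal G(F)$ has the topology coming from $F$; $S=\mathcal S(F)$ and $Z_G(S)=Z_{\mathcal G}(\mathcal S)(F)$. For an $F$-cocharacter $\lambda:GL_1\to\mathcal G$: $\mathcal P_{\mathcal G}(\lambda)$ is the $F$-subgroup of those $g$ for which $\lim_{t\to0}\lambda(t)g\lambda(t)^{-1}$ exists, $\mathcal U_{\mathcal G}(\lambda)$ the subgroup where this limit is $1$, and $\mathcal Z_{\mathcal G}(\lambda)=\mathcal P_{\mathcal G}(\lambda)\cap\mathcal P_{\mathcal G}(\lambda^{-1})$, the centralizer of $\lambda$. The pseudo-parabolic $F$-subgroups of $\mathcal G$ are the groups $\mathcal P_{\mathcal G}(\lambda)\mathcal R_{u,F}(\mathcal G)$, where $\mathcal R_{u,F}(\mathcal G)$ is the largest smooth connected normal unipotent $F$-subgroup. Those containing $Z_{\mathcal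 G}(\mathcal S)$ are of the form $\mathcal P_{\mathcal G}(\lambda)$ with $\lambda:GL_1\to\mathcal S$. A pair of opposite pseudo-parabolic $F$-subgroups of $G$ containing $Z_G(S)$ is $P=\mathcal P_{\mathcal G}(\lambda)(F)$, $\bar P=\mathcal P_{\mathcal G}(\lambda^{-1})(F)$ for such a $\lambda$, with $M=\mathcal Z_{\mathcal G}(\lambda)(F)$, $U=\mathcal U_{\mathcal G}(\lambda)(F)$, $\bar U=\mathcal U_{\mathcal G}(\lambda^{-1})(F)$. *)

theory Defs
  imports "HOL-Analysis.Analysis" "HOL-Algebra.Algebraic_Closure_Type"
begin

section \<open>Non-archimedean local fields\<close>

text \<open>
  The absolute value is \<open>dist 0\<close>, and the topology is the metric one. The field is complete for a
  discrete, nontrivial valuation and has finite residue field; every characteristic is allowed.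
\<close>

class nonarch_local_field = field + complete_space +
  assumes dist_add_right_cancel: "dist (x + z) (y + z) = dist x y"
    and dist_zero_mult: "dist 0 (x * y) = dist 0 x * dist 0 y"
    and dist_ultrametric: "dist x z \<le> max (dist x y) (dist y z)"
    and discrete_valuation:
      "\<exists>p. 0 < dist 0 p \<and> dist 0 p < 1 \<and> (\<forall>x. x \<noteq> 0 \<longrightarrow> (\<exists>k::int. dist 0 x = dist 0 p powi k))"
    and finite_residue_field:
      "finite ({x. dist 0 x \<le> 1} // {(x, y). dist 0 x \<le> 1 \<and> dist 0 y \<le> 1 \<and> dist x y < 1})"


section \<open>Regular functions\<close>

text \<open>
  \<open>gen_algebra C B\<close> is the algebra of functions generated by the functions in \<open>B\<close> and the
  constants in \<open>C\<close>. All varieties below are described by their points over an algebraic closure,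
  which is infinite, so that regular functions on them may be identified with genuine functions.
\<close>

inductive_set gen_algebra :: "'k::comm_ring_1 set \<Rightarrow> ('a \<Rightarrow> 'k) set \<Rightarrow> ('a \<Rightarrow> 'k) set"
  for C :: "'k set" and B :: "('a \<Rightarrow> 'k) set" where
  const: "c \<in> C \<Longrightarrow> (\<lambda>_. c) \<in> gen_algebra C B"
| gen: "f \<in> B \<Longrightarrow> f \<in> gen_algebra C B"
| add: "f \<in> gen_algebra C B \<Longrightarrow> g \<in> gen_algebra C B \<Longrightarrow> (\<lambda>x. f x + g x) \<in> gen_algebra C B"
| mult: "f \<in> gen_algebra C B \<Longrightarrow> g \<in> gen_algebra C B \<Longrightarrow> (\<lambda>x. f x * g x) \<in> gen_algebra C B"

text \<open>Agreement is only required on \<open>D\<close>, so junk values outside \<open>D\<close> (such as \<open>inverse 0\<close>) play no role.\<close>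

definition regular_on :: "'k::comm_ring_1 set \<Rightarrow> ('a \<Rightarrow> 'k) set \<Rightarrow> 'a set \<Rightarrow> ('a \<Rightarrow> 'k) \<Rightarrow> bool" where
  "regular_on C B D f \<longleftrightarrow> (\<exists>h \<in> gen_algebra C B. \<forall>x\<in>D. f x = h x)"

text \<open>The field \<open>F\<close>, viewed inside its algebraic closure.\<close>

abbreviation base_field :: "'f::field alg_closure set" where
  "base_field \<equiv> range to_ac"

definition GL :: "('k::field ^ 'n ^ 'n) set" where
  "GL = {A. invertible A}"

definition GL_coords :: "('k::field ^ 'n ^ 'n \<Rightarrow> 'k) set" where
  "GL_coords = {\<lambda>A. A $ i $ j | i j. True} \<union> {\<lambda>A. inverse (det A)}"

abbreviation regular_GL :: "'k::field set \<Rightarrow> ('k ^ 'n ^ 'n) set \<Rightarrow> ('k ^ 'n ^ 'n \<Rightarrow> 'k) \<Rightarrow> bool" where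
  "regular_GL C D f \<equiv> regular_on C GL_coords D f"


section \<open>Linear algebraic groups over a field\<close>

text \<open>
  A linear algebraic (that is, smooth affine) \<open>F\<close>-group is given by the set of its points over
  the algebraic closure of \<open>F\<close>, a Zariski closed subgroup of some \<open>GL\<^sub>n\<close> that is defined over \<open>F\<close>:
  its full (radical) vanishing ideal is generated by functions with coefficients in \<open>F\<close>.
  Over imperfect fields this is stronger than being the zero locus of functions over \<open>F\<close>, and it
  is exactly smoothness of the corresponding closed \<open>F\<close>-subgroup scheme.
\<close>

definition zariski_closed :: "('k::field ^ 'n ^ 'n) set \<Rightarrow> bool" where
  "zariski_closed Z \<longleftrightarrow>
     (\<exists>E \<subseteq> gen_algebra UNIV GL_coords. Z = {A \<in> GL. \<forall>f\<in>E. f A = 0})"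

definition defined_over_base :: "('f::field alg_closure ^ 'n ^ 'n) set \<Rightarrow> bool" where
  "defined_over_base Z \<longleftrightarrow>
     (\<forall>f \<in> gen_algebra UNIV GL_coords. (\<forall>A\<in>Z. f A = 0) \<longrightarrow>
        (\<exists>T c. finite T \<and> T \<subseteq> {h \<in> gen_algebra base_field GL_coords. \<forall>A\<in>Z. h A = 0} \<and>
               (\<forall>h\<in>T. c h \<in> gen_algebra UNIV GL_coords) \<and>
               (\<forall>A\<in>GL. f A = (\<Sum>h\<in>T. c h A * h A))))"

definition matrix_group :: "('k::field ^ 'n ^ 'n) set \<Rightarrow> bool" where
  "matrix_group G \<longleftrightarrow> G \<subseteq> GL \<and> mat 1 \<in> G \<and> (\<forall>A\<in>G. \<forall>B\<in>G. A ** B \<in> G) \<and> (\<forall>A\<in>G. matrix_inv A \<in> G)"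

definition linear_algebraic_group :: "('f::field alg_closure ^ 'n ^ 'n) set \<Rightarrow> bool" where
  "linear_algebraic_group G \<longleftrightarrow> matrix_group G \<and> zariski_closed G \<and> defined_over_base G"

definition zariski_connected :: "('k::field ^ 'n ^ 'n) set \<Rightarrow> bool" where
  "zariski_connected G \<longleftrightarrow>
     (\<forall>Y Z. zariski_closed Y \<and> zariski_closed Z \<and> Y \<union> Z = G \<and> Y \<inter> Z = {} \<longrightarrow> Y = {} \<or> Z = {})"

definition normal_in :: "('k::field ^ 'n ^ 'n) set \<Rightarrow> ('k ^ 'n ^ 'n) set \<Rightarrow> bool" where
  "normal_in N G \<longleftrightarrow> N \<subseteq> G \<and> (\<forall>g\<in>G. \<forall>n\<in>N. g ** n ** matrix_inv g \<in> N)"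


section \<open>Split unipotent groups and quasi-reductive groups\<close>

text \<open>
  An isomorphism of \<open>U/V\<close> with the additive group over \<open>F\<close> is a surjective \<open>F\<close>-homomorphism
  from \<open>U\<close> whose scheme-theoretic kernel is \<open>V\<close>. The last clause says that the vanishing ideal of
  \<open>V\<close> in the coordinate ring of \<open>U\<close> is generated by the homomorphism; the kernel on points alone
  would also allow inseparable homomorphisms.
\<close>

definition quotient_is_Ga ::
    "('f::field alg_closure ^ 'n ^ 'n) set \<Rightarrow> ('f alg_closure ^ 'n ^ 'n) set \<Rightarrow> bool" where
  "quotient_is_Ga U V \<longleftrightarrow>
     (\<exists>\<theta>. regular_GL base_field U \<theta> \<and>
          (\<forall>u\<in>U. \<forall>w\<in>U. \<theta> (u ** w) = \<theta> u + \<theta> w) \<and>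
          \<theta> ` U = UNIV \<and>
          V = {u \<in> U. \<theta> u = 0} \<and>
          (\<forall>f \<in> gen_algebra UNIV GL_coords. (\<forall>v\<in>V. f v = 0) \<longrightarrow>
             (\<exists>h \<in> gen_algebra UNIV GL_coords. \<forall>u\<in>U. f u = h u * \<theta> u)))"

text \<open>
  A smooth connected group with a composition series over \<open>F\<close> whose successive quotients are
  additive groups. Such a group is automatically unipotent.
\<close>

inductive split_unipotent :: "('f::field alg_closure ^ 'n ^ 'n) set \<Rightarrow> bool" where
  trivial: "split_unipotent {mat 1}"
| extension: "split_unipotent V \<Longrightarrow> linear_algebraic_group U \<Longrightarrow> zariski_connected U \<Longrightarrow>
    normal_in V U \<Longrightarrow> quotient_is_Ga U V \<Longrightarrow> split_unipotent U"

definition split_unipotent_normal_subgroup ::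
    "('f::field alg_closure ^ 'n ^ 'n) set \<Rightarrow> ('f alg_closure ^ 'n ^ 'n) set \<Rightarrow> bool" where
  "split_unipotent_normal_subgroup G N \<longleftrightarrow>
     linear_algebraic_group N \<and> zariski_connected N \<and> normal_in N G \<and> split_unipotent N"

definition largest_split_unipotent_normal_subgroup ::
    "('f::field alg_closure ^ 'n ^ 'n) set \<Rightarrow> ('f alg_closure ^ 'n ^ 'n) set \<Rightarrow> bool" where
  "largest_split_unipotent_normal_subgroup G N \<longleftrightarrow>
     split_unipotent_normal_subgroup G N \<and>
     (\<forall>N'. split_unipotent_normal_subgroup G N' \<longrightarrow> N' \<subseteq> N)"

definition quasi_reductive :: "('f::field alg_closure ^ 'n ^ 'n) set \<Rightarrow> bool" where
  "quasi_reductive G \<longleftrightarrow>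
     linear_algebraic_group G \<and> zariski_connected G \<and>
     largest_split_unipotent_normal_subgroup G {mat 1}"


section \<open>Split tori and cocharacters\<close>

definition Gm_power :: "nat \<Rightarrow> (nat \<Rightarrow> 'k::field) set" where
  "Gm_power r = {..<r} \<rightarrow>\<^sub>E (UNIV - {0})"

definition Gm_power_coords :: "nat \<Rightarrow> ((nat \<Rightarrow> 'k::field) \<Rightarrow> 'k) set" where
  "Gm_power_coords r = {\<lambda>x. x i | i. i < r} \<union> {\<lambda>x. inverse (x i) | i. i < r}"

text \<open>\<open>\<phi>\<close> and \<open>\<psi>\<close> are mutually inverse isomorphisms of \<open>F\<close>-groups between \<open>GL\<^sub>1\<^sup>r\<close> and \<open>S\<close>.\<close>

definition split_torus :: "('f::field alg_closure ^ 'n ^ 'n) set \<Rightarrow> bool" where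
  "split_torus S \<longleftrightarrow> linear_algebraic_group S \<and>
     (\<exists>r \<phi> \<psi>.
        (\<forall>i j. regular_on base_field (Gm_power_coords r) (Gm_power r) (\<lambda>x. \<phi> x $ i $ j)) \<and>
        (\<forall>i<r. regular_GL base_field S (\<lambda>s. \<psi> s i)) \<and>
        (\<forall>x \<in> Gm_power r. \<forall>y \<in> Gm_power r. \<phi> (\<lambda>i\<in>{..<r}. x i * y i) = \<phi> x ** \<phi> y) \<and>
        (\<forall>x \<in> Gm_power r. \<phi> x \<in> S \<and> \<psi> (\<phi> x) = x) \<and>
        (\<forall>s \<in> S. \<psi> s \<in> Gm_power r \<and> \<phi> (\<psi> s) = s))"

definition maximal_split_torus ::
    "('f::field alg_closure ^ 'n ^ 'n) set \<Rightarrow> ('f alg_closure ^ 'n ^ 'n) set \<Rightarrow> bool" where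
  "maximal_split_torus G S \<longleftrightarrow>
     split_torus S \<and> S \<subseteq> G \<and> (\<forall>T. split_torus T \<and> T \<subseteq> G \<and> S \<subseteq> T \<longrightarrow> T = S)"

text \<open>
  \<open>F\<close>-cocharacters \<open>GL\<^sub>1 \<rightarrow> S\<close>. The value at \<open>0\<close> is irrelevant.
\<close>

definition cocharacter ::
    "('f::field alg_closure ^ 'n ^ 'n) set \<Rightarrow> ('f alg_closure \<Rightarrow> 'f alg_closure ^ 'n ^ 'n) \<Rightarrow> bool" where
  "cocharacter S \<mu> \<longleftrightarrow>
     (\<forall>i j. regular_on base_field {\<lambda>t. t, \<lambda>t. inverse t} (UNIV - {0}) (\<lambda>t. \<mu> t $ i $ j)) \<and>
     (\<forall>t. t \<noteq> 0 \<longrightarrow> \<mu> t \<in> S) \<and>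
     (\<forall>s t. s \<noteq> 0 \<and> t \<noteq> 0 \<longrightarrow> \<mu> (s * t) = \<mu> s ** \<mu> t)"

definition inverse_cochar :: "('k::field \<Rightarrow> 'k ^ 'n ^ 'n) \<Rightarrow> 'k \<Rightarrow> 'k ^ 'n ^ 'n" where
  "inverse_cochar \<mu> t = matrix_inv (\<mu> t)"


section \<open>Pseudo-parabolic subgroups\<close>

text \<open>
  The limit exists and equals \<open>l\<close> if the morphism \<open>t \<mapsto> \<mu>(t) g \<mu>(t)\<^sup>-\<^sup>1\<close> from \<open>GL\<^sub>1\<close> to \<open>G\<close> extends
  to a morphism from the affine line to \<open>G\<close> with value \<open>l\<close> at \<open>0\<close>.
\<close>

definition has_limit_at_0 ::
    "('k::field ^ 'n ^ 'n) set \<Rightarrow> ('k \<Rightarrow> 'k ^ 'n ^ 'n) \<Rightarrow> 'k ^ 'n ^ 'n \<Rightarrow> 'k ^ 'n ^ 'n \<Rightarrow> bool" where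
  "has_limit_at_0 G \<mu> g l \<longleftrightarrow>
     (\<exists>q. (\<forall>i j. regular_on UNIV {\<lambda>t. t} UNIV (\<lambda>t. q t $ i $ j)) \<and>
          (\<forall>t. q t \<in> G) \<and>
          (\<forall>t. t \<noteq> 0 \<longrightarrow> q t = \<mu> t ** g ** matrix_inv (\<mu> t)) \<and>
          q 0 = l)"

definition P_group :: "('k::field ^ 'n ^ 'n) set \<Rightarrow> ('k \<Rightarrow> 'k ^ 'n ^ 'n) \<Rightarrow> ('k ^ 'n ^ 'n) set" where
  "P_group G \<mu> = {g \<in> G. \<exists>l. has_limit_at_0 G \<mu> g l}"

definition U_group :: "('k::field ^ 'n ^ 'n) set \<Rightarrow> ('k \<Rightarrow> 'k ^ 'n ^ 'n) \<Rightarrow> ('k ^ 'n ^ 'n) set" where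
  "U_group G \<mu> = {g \<in> G. has_limit_at_0 G \<mu> g (mat 1)}"

definition Z_group :: "('k::field ^ 'n ^ 'n) set \<Rightarrow> ('k \<Rightarrow> 'k ^ 'n ^ 'n) \<Rightarrow> ('k ^ 'n ^ 'n) set" where
  "Z_group G \<mu> = P_group G \<mu> \<inter> P_group G (inverse_cochar \<mu>)"

definition rational_points :: "('f::field alg_closure ^ 'n ^ 'n) set \<Rightarrow> ('f ^ 'n ^ 'n) set" where
  "rational_points G = {A. map_matrix to_ac A \<in> G}"

text \<open>
  Pairs \<open>P = MU\<close>, \<open>P' = MU'\<close> of opposite pseudo-parabolic subgroups containing the centralizer
  of \<open>S\<close>. These are the ones defined by cocharacters with values in \<open>S\<close>: for such a cocharacter the
  centralizer of \<open>S\<close> is contained in \<open>M\<close>.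
\<close>

definition opposite_pseudo_parabolics ::
    "('f::field alg_closure ^ 'n ^ 'n) set \<Rightarrow> ('f alg_closure ^ 'n ^ 'n) set \<Rightarrow>
     ('f ^ 'n ^ 'n) set \<Rightarrow> ('f ^ 'n ^ 'n) set \<Rightarrow> ('f ^ 'n ^ 'n) set \<Rightarrow>
     ('f ^ 'n ^ 'n) set \<Rightarrow> ('f ^ 'n ^ 'n) set \<Rightarrow> bool" where
  "opposite_pseudo_parabolics G S P P' M U U' \<longleftrightarrow>
     (\<exists>\<mu>. cocharacter S \<mu> \<and>
        P = rational_points (P_group G \<mu>) \<and>
        P' = rational_points (P_group G (inverse_cochar \<mu>)) \<and>
        M = rational_points (Z_group G \<mu>) \<and>
        U = rational_points (U_group G \<mu>) \<and>
        U' = rational_points (U_group G (inverse_cochar \<mu>)))"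


section \<open>Compact open subgroups with Iwahori decomposition\<close>

text \<open>
  The group of rational points has the subspace topology of the space of matrices over \<open>F\<close>.
\<close>

definition compact_open_subgroup ::
    "('f::nonarch_local_field ^ 'n ^ 'n) set \<Rightarrow> ('f ^ 'n ^ 'n) set \<Rightarrow> bool" where
  "compact_open_subgroup G K \<longleftrightarrow>
     K \<subseteq> G \<and> matrix_group K \<and> compact K \<and> openin (top_of_set G) K"

definition iwahori_decomposition ::
    "('f::field alg_closure ^ 'n ^ 'n) set \<Rightarrow> ('f alg_closure ^ 'n ^ 'n) set \<Rightarrow>
     ('f ^ 'n ^ 'n) set \<Rightarrow> bool" where
  "iwahori_decomposition G S K \<longleftrightarrow>
     (\<forall>P P' M U U'. opposite_pseudo_parabolics G S P P' M U U' \<longrightarrow>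
        bij_betw (\<lambda>(u, m, u'). u ** m ** u') ((K \<inter> U) \<times> (K \<inter> M) \<times> (K \<inter> U')) K)"

end

theory Submission
  imports Defs
begin

text \<open>
  Write \<open>S\<close> as the image of \<open>GL\<^sub>1\<^sup>r\<close>. Linear independence of characters turns the embedding of \<open>S\<close> into a
  system of orthogonal idempotents \<open>E i\<close> over \<open>F\<close> such that every cocharacter \<open>\<mu>\<close> of \<open>S\<close> is
  \<open>\<mu> t = (\<Sum>i. t powi k i \<cdot> E i)\<close>. The groups \<open>P\<close>, \<open>M\<close>, \<open>U\<close> are then cut out of \<open>G\<close> by the vanishing of blocks
  \<open>E i A E j\<close>, and depend on the weights \<open>k\<close> only through the signs of \<open>k i - k j\<close>, so only finitely many
  occur. The subgroup \<open>K\<close> consists of the rational points all of whose blocks are close to those of \<open>1\<close>.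

  That the factors of a small element of \<open>G(F)\<close> lie again in \<open>G(F)\<close> is not obtained from the open cell
  of \<open>G\<close>, but from topological dynamics: conjugation by \<open>\<mu>(\<pi>)\<close>, for a nonunit \<open>\<pi>\<close>, contracts \<open>U\<close> and
  expands the opposite group, and Willis' tidying argument for automorphisms of totally disconnected
  locally compact groups decomposes a neighbourhood of \<open>1\<close> accordingly.
\<close>

section \<open>The topology of a local field\<close>

text \<open>The obstacle is uniformity. Compactness yields, for one weight function
  \<open>k\<close>, a neighbourhood of unspecified size whose elements factor, and the factors are
  only known to lie in the congruence subgroup of a fixed radius \<open>e\<close>; one
  \<open>K\<close> has to serve all \<open>k\<close> and to contain the factors itself. Two facts
  repair this. Factors of radius \<open>e\<close> of an element of radius \<open>d \<le> e\<close>
  automatically have radius \<open>d\<close>, so the same congruence subgroup holds the product and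
  its factors. And existence depends only on the sign pattern of \<open>k\<close>, so finitely many
  radii have a positive minimum. Distances to 1 are measured on the blocks
  \<open>E i ** A ** E j\<close>, not on entries: the \<open>E i\<close> may have non-integral
  entries, and on blocks the passage to a limit and conjugation by a cocharacter act by scalars,
  without constants. Thus one family of congruence subgroups suits all \<open>k\<close> at once. The
  dynamical argument uses three properties of G(F): it is closed inside small congruence subgroups,
  stable under conjugation by values of cocharacters of S, and contains the limits that
  exist.\<close>

definition av :: "'f::nonarch_local_field \<Rightarrow> real" where
  "av x = dist 0 x"

lemma dist_eq_av: "dist x y = av (x - y)" for x y :: "'f::nonarch_local_field"
  using dist_add_right_cancel[of x "-y" y] by (simp add: dist_commute av_def)

lemma av_nonneg [simp]: "0 \<le> av x"
  and av_eq_0_iff [simp]: "av x = 0 \<longleftrightarrow> x = 0"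
  and av_0 [simp]: "av 0 = 0"
  and av_pos_iff [simp]: "0 < av x \<longleftrightarrow> x \<noteq> 0"
  by (auto simp: av_def)

lemma av_mult: "av (x * y) = av x * av y"
  by (simp add: av_def dist_zero_mult)

lemma av_minus [simp]: "av (- x) = av x"
  using dist_add_right_cancel[of 0 x "-x"] by (simp add: dist_commute av_def)

lemma av_minus_commute: "av (x - y) = av (y - x)"
  using av_minus[of "x - y"] by simp

lemma av_add_le: "av x \<le> c \<Longrightarrow> av y \<le> c \<Longrightarrow> av (x + y) \<le> c"
  using dist_ultrametric[of 0 "x + y" y] dist_eq_av[of 0 "x + y"] dist_eq_av[of 0 y] dist_eq_av[of y "x + y"]
    av_minus[of "x + y"] by simp

lemma av_diff_le: "av x \<le> c \<Longrightarrow> av y \<le> c \<Longrightarrow> av (x - y) \<le> c"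
  using av_add_le[of x c "-y"] by simp

lemma av_one [simp]: "av (1::'f::nonarch_local_field) = 1"
proof -
  have "av (1::'f) * av (1::'f) = av (1::'f)" "av (1::'f) \<noteq> 0"
    by (simp_all flip: av_mult)
  then show ?thesis by simp
qed

lemma av_inverse: "av (inverse x) = inverse (av x)" for x :: "'f::nonarch_local_field"
proof (cases "x = 0")
  case False
  then have "av x * av (inverse x) = 1" by (simp flip: av_mult)
  then show ?thesis by (simp add: inverse_unique)
qed simp

lemma av_divide: "av (x / y) = av x / av y"
  by (simp add: divide_inverse av_mult av_inverse)

lemma av_power: "av (x ^ n) = av x ^ n" for x :: "'f::nonarch_local_field"
  by (induction n) (simp_all add: av_mult)

lemma av_sum_le:
  fixes f :: "'b \<Rightarrow> 'f::nonarch_local_field"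
  shows "0 \<le> c \<Longrightarrow> (\<And>i. i \<in> I \<Longrightarrow> av (f i) \<le> c) \<Longrightarrow> av (sum f I) \<le> c"
  by (induction I rule: infinite_finite_induct) (simp_all add: av_add_le)

text \<open>In an ultrametric triangle the two longest sides agree, so the absolute value is locally
  constant away from 0.\<close>

lemma av_eqI:
  assumes "av (x - y) < av y"
  shows "av x = av y"
proof -
  have "av x \<le> av y"
    using assms av_add_le[of "x - y" "av y" y] by simp
  moreover have "av y \<le> max (av x) (av (x - y))"
    using av_diff_le[of x "max (av x) (av (x - y))" "x - y"] by simp
  ultimately show ?thesis using assms by auto
qed

lemma tendsto_iff_av:
  "(f \<longlongrightarrow> (l::'f::nonarch_local_field)) F \<longleftrightarrow> (\<forall>e>0. \<forall>\<^sub>F x in F. av (f x - l) < e)"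
  by (simp add: tendsto_iff dist_eq_av)


lemma eventually_nhds_av: "e > 0 \<Longrightarrow> \<forall>\<^sub>F x in nhds a. av (x - a) < e" for a :: "'f::nonarch_local_field"
  by (auto simp: eventually_nhds_metric dist_eq_av)

instance nonarch_local_field \<subseteq> topological_ab_group_add
proof
  fix a b :: 'a
  show "LIM x nhds a \<times>\<^sub>F nhds b. fst x + snd x :> nhds (a + b)"
    unfolding tendsto_iff_av
  proof (intro allI impI)
    fix e :: real assume "e > 0"
    then have "\<forall>\<^sub>F x in nhds a \<times>\<^sub>F nhds b. av (fst x - a) < e \<and> av (snd x - b) < e"
      by (intro eventually_prodI eventually_nhds_av)
    then show "\<forall>\<^sub>F x in nhds a \<times>\<^sub>F nhds b. av (fst x + snd x - (a + b)) < e"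
    proof eventually_elim
      case (elim x)
      then have "av ((fst x - a) + (snd x - b)) \<le> max (av (fst x - a)) (av (snd x - b))"
        by (intro av_add_le) auto
      also have "\<dots> < e" using elim by simp
      also have "(fst x - a) + (snd x - b) = fst x + snd x - (a + b)" by simp
      finally show ?case .
    qed
  qed
  show "(uminus \<longlongrightarrow> - a) (nhds a)"
    unfolding tendsto_iff_av
  proof (intro allI impI)
    fix e :: real assume "e > 0"
    then show "\<forall>\<^sub>F x in nhds a. av (- x - - a) < e"
      using eventually_nhds_av[of e a] av_minus[of "_ - a"] by simp
  qed
qed

instance nonarch_local_field \<subseteq> topological_comm_monoid_mult
proof
  fix a b :: 'a
  show "LIM x nhds a \<times>\<^sub>F nhds b. fst x * snd x :> nhds (a * b)"
    unfolding tendsto_iff_av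
  proof (intro allI impI)
    fix e :: real assume e: "e > 0"
    \<comment> \<open>\<open>c\<close> bounds \<open>av a\<close>, \<open>av b\<close> and, since
      \<open>d \<le> 1\<close>, also \<open>av (snd x)\<close> near \<open>b\<close>. The error is
      split as \<open>(fst x - a) * snd x + a * (snd x - b)\<close>, of size at most
      \<open>c * d\<close>.\<close>
    define c where "c = 1 + av a + av b"
    have c: "c > 0" "av a < c" "av b < c" "1 \<le> c" using av_nonneg[of a] av_nonneg[of b]
      unfolding c_def by linarith+
    define d where "d = min 1 (e / (2 * c))"
    have d: "d > 0" "d \<le> 1" "c * d < e" using e c by (auto simp: d_def min_def field_simps)
    have "\<forall>\<^sub>F x in nhds a \<times>\<^sub>F nhds b. av (fst x - a) < d \<and> av (snd x - b) < d"
      using d by (intro eventually_prodI eventually_nhds_av)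
    then show "\<forall>\<^sub>F x in nhds a \<times>\<^sub>F nhds b. av (fst x * snd x - a * b) < e"
    proof eventually_elim
      case (elim x)
      have "av (snd x) \<le> c"
        using av_add_le[of "snd x - b" c b] elim d c by simp
      then have "av (fst x - a) * av (snd x) \<le> d * c" "av a * av (snd x - b) \<le> c * d"
        using elim c d by (auto intro!: mult_mono)
      then have "av ((fst x - a) * snd x + a * (snd x - b)) \<le> c * d"
        by (intro av_add_le) (auto simp: av_mult mult.commute)
      then show ?case using d by (simp add: algebra_simps)
    qed
  qed
qed

lemma tendsto_inverse_av:
  fixes f :: "'b \<Rightarrow> 'f::nonarch_local_field"
  assumes f: "(f \<longlongrightarrow> l) F" and l: "l \<noteq> 0"
  shows "((\<lambda>x. inverse (f x)) \<longlongrightarrow> inverse l) F"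
  unfolding tendsto_iff_av
proof (intro allI impI)
  fix e :: real assume e: "e > 0"
  have pos: "av l > 0" using l by simp
  \<comment> \<open>The first bound forces \<open>av (f x) = av l\<close> through
    \<open>av_eqI\<close>; the second pays for the two factors \<open>inverse (av l)\<close> in the
    difference of the inverses.\<close>
  then have "min (av l) (e * (av l * av l)) > 0" using e by simp
  then have "\<forall>\<^sub>F x in F. av (f x - l) < min (av l) (e * (av l * av l))"
    using f unfolding tendsto_iff_av by blast
  then show "\<forall>\<^sub>F x in F. av (inverse (f x) - inverse l) < e"
  proof eventually_elim
    case (elim x)
    then have eq: "av (f x) = av l" by (intro av_eqI) simp
    then have "f x \<noteq> 0" using pos by auto
    then have "inverse (f x) - inverse l = - ((f x - l) * (inverse (f x) * inverse l))"
      using l by (simp add: field_simps)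
    then have "av (inverse (f x) - inverse l) = av (f x - l) * (inverse (av l) * inverse (av l))"
      using eq by (simp add: av_minus av_mult av_inverse)
    also have "\<dots> < e" using elim pos by (simp add: field_simps)
    finally show ?case .
  qed
qed

lemma continuous_on_inverse_av [continuous_intros]:
  fixes f :: "'b::topological_space \<Rightarrow> 'f::nonarch_local_field"
  shows "continuous_on S f \<Longrightarrow> (\<And>x. x \<in> S \<Longrightarrow> f x \<noteq> 0) \<Longrightarrow> continuous_on S (\<lambda>x. inverse (f x))"
  unfolding continuous_on_def by (auto intro: tendsto_inverse_av)

lemma open_av_le: "c > 0 \<Longrightarrow> open {x::'f::nonarch_local_field. av x \<le> c}"
  unfolding open_dist
proof (intro ballI exI conjI)
  fix x y :: 'f assume "c > 0" "x \<in> {x. av x \<le> c}"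
  then show "\<forall>y. dist y x < c \<longrightarrow> y \<in> {x. av x \<le> c}"
    using av_add_le[of "_ - x" c x] by (auto simp: dist_eq_av)
qed

lemma closed_av_le: "closed {x::'f::nonarch_local_field. av x \<le> c}"
  using closed_cball[of "0::'f" c] by (simp add: cball_def dist_eq_av)

section \<open>Compactness of balls in the field\<close>

lemma uniformizer_exists:
  obtains p :: "'f::nonarch_local_field"
  where "0 < av p" "av p < 1" "\<And>x::'f. av x < 1 \<Longrightarrow> av x \<le> av p"
proof -
  obtain p :: 'f where p: "0 < av p" "av p < 1" and v: "\<And>x::'f. x \<noteq> 0 \<Longrightarrow> \<exists>k::int. av x = av p powi k"
    using discrete_valuation unfolding av_def by blast
  have "av x \<le> av p" if "av x < 1" for x :: 'f
  proof (cases "x = 0")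
    case False
    then obtain k :: int where k: "av x = av p powi k" using v by blast
    have "k \<ge> 1"
    proof (rule ccontr)
      assume "\<not> 1 \<le> k"
      then have "1 \<le> inverse (av p) ^ nat (- k)" using p by (intro one_le_power) (simp add: one_le_inverse)
      then show False using k that \<open>\<not> 1 \<le> k\<close> p by (cases "k = 0") (auto simp: power_int_def)
    qed
    then have "av x = av p ^ nat k" using k by (simp add: power_int_def)
    also have "\<dots> \<le> av p ^ 1" using p \<open>k \<ge> 1\<close> by (intro power_decreasing) auto
    finally show ?thesis by simp
  qed (use p in simp)
  then show ?thesis using that p by blast
qed

text \<open>Digit expansion: with \<open>B\<close> representing the residue classes,
  \<open>x = b + p * x'\<close> for some \<open>b\<close> in \<open>B\<close> and \<open>x'\<close>
  again in the unit ball, and \<open>x'\<close> is approximated to one order less.\<close>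

lemma finite_cover_unit_ball:
  fixes p :: "'f::nonarch_local_field"
  assumes p: "0 < av p" "av p < 1" "\<And>x::'f. av x < 1 \<Longrightarrow> av x \<le> av p"
  shows "\<exists>A::'f set. finite A \<and> (\<forall>x. av x \<le> 1 \<longrightarrow> (\<exists>a\<in>A. av (x - a) \<le> av p ^ n))"
proof (induction n)
  case 0
  then show ?case by (intro exI[of _ "{0}"]) auto
next
  case (Suc n)
  define r :: "('f \<times> 'f) set" where "r = {(x, y). av x \<le> 1 \<and> av y \<le> 1 \<and> dist x y < 1}"
  have "finite ({x::'f. av x \<le> 1} // r)" unfolding r_def av_def by (rule finite_residue_field)
  define B where "B = (\<lambda>C. SOME x. x \<in> C) ` ({x::'f. av x \<le> 1} // r)"
  have B: "finite B" unfolding B_def using \<open>finite _\<close> by simp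
  have Bx: "\<exists>b\<in>B. av (x - b) \<le> av p" if "av x \<le> 1" for x
  proof -
    let ?b = "SOME y. y \<in> r `` {x}"
    have "x \<in> r `` {x}" using that by (simp add: r_def)
    then have b: "?b \<in> r `` {x}" by (rule someI)
    have "av (x - b) \<le> av p" if "b \<in> r `` {x}" for b
      using that p(3) by (simp add: r_def dist_eq_av)
    then have "av (x - ?b) \<le> av p" using b .
    moreover have "r `` {x} \<in> {x. av x \<le> 1} // r" using that by (intro quotientI) simp
    then have "?b \<in> B" unfolding B_def by (rule image_eqI[OF refl])
    ultimately show ?thesis by blast
  qed
  obtain A :: "'f set" where A: "finite A" "\<And>x. av x \<le> 1 \<Longrightarrow> \<exists>a\<in>A. av (x - a) \<le> av p ^ n"
    using Suc by blast
  have "\<exists>c \<in> (\<lambda>(b, a). b + p * a) ` (B \<times> A). av (x - c) \<le> av p ^ Suc n" if x: "av x \<le> 1" for x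
  proof -
    obtain b where b: "b \<in> B" "av (x - b) \<le> av p" using Bx x by blast
    have p0: "p \<noteq> 0" using p by auto
    then have "av ((x - b) / p) \<le> 1" using b p by (simp add: av_divide)
    then obtain a where a: "a \<in> A" "av ((x - b) / p - a) \<le> av p ^ n" using A by blast
    have "x - (b + p * a) = p * ((x - b) / p - a)" using p0 by (simp add: field_simps)
    then have "av (x - (b + p * a)) = av p * av ((x - b) / p - a)" by (simp add: av_mult)
    also have "\<dots> \<le> av p ^ Suc n" using a p by (simp add: mult_left_mono)
    finally show ?thesis using a b by force
  qed
  moreover have "finite ((\<lambda>(b, a). b + p * a) ` (B \<times> A))" using A(1) B by simp
  ultimately show ?case by blast
qed

lemma compact_av_le_one: "compact {x::'f::nonarch_local_field. av x \<le> 1}"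
  unfolding compact_eq_totally_bounded
proof (intro conjI allI impI)
  show "complete {x::'f. av x \<le> 1}" using closed_av_le by (simp add: complete_eq_closed)
  fix e :: real assume "e > 0"
  obtain p :: 'f where p: "0 < av p" "av p < 1" "\<And>x::'f. av x < 1 \<Longrightarrow> av x \<le> av p"
    by (rule uniformizer_exists) blast
  obtain n where n: "av p ^ n < e" using real_arch_pow_inv[OF \<open>e > 0\<close> p(2)] by blast
  obtain A :: "'f set" where "finite A" and A: "\<And>x. av x \<le> 1 \<Longrightarrow> \<exists>a\<in>A. av (x - a) \<le> av p ^ n"
    using finite_cover_unit_ball[OF p] by blast
  have "{x. av x \<le> 1} \<subseteq> (\<Union>a\<in>A. ball a e)"
  proof
    fix x :: 'f assume "x \<in> {x. av x \<le> 1}"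
    then obtain a where "a \<in> A" "av (x - a) \<le> av p ^ n" using A by blast
    then show "x \<in> (\<Union>a\<in>A. ball a e)" using n by (intro UN_I[of a]) (simp_all add: dist_eq_av av_minus_commute)
  qed
  then show "\<exists>k. finite k \<and> {x::'f. av x \<le> 1} \<subseteq> (\<Union>x\<in>k. ball x e)" using \<open>finite A\<close> by blast
qed

lemma compact_av_le: "compact {x::'f::nonarch_local_field. av x \<le> c}"
proof -
  obtain p :: 'f where p: "0 < av p" "av p < 1" by (rule uniformizer_exists) blast
  obtain n where n: "c < inverse (av p) ^ n" using real_arch_pow[of "inverse (av p)" c] p
    by (auto simp: one_less_inverse)
  have p0: "p \<noteq> 0" using p by auto
  have "compact ((\<lambda>x. inverse p ^ n * x) ` {x::'f. av x \<le> 1})"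
    by (intro compact_continuous_image compact_av_le_one continuous_intros)
  moreover have "{x. av x \<le> c} \<subseteq> (\<lambda>x. inverse p ^ n * x) ` {x::'f. av x \<le> 1}"
  proof
    fix x :: 'f assume "x \<in> {x. av x \<le> c}"
    then have x: "av x \<le> c" by simp
    have "av p ^ n * av x \<le> av p ^ n * inverse (av p) ^ n"
      using x n by (intro mult_left_mono) auto
    then have "av (p ^ n * x) \<le> 1" using p0
      by (simp add: av_mult av_power power_inverse)
    moreover have "x = inverse p ^ n * (p ^ n * x)" using p0 by (simp add: power_inverse)
    ultimately show "x \<in> (\<lambda>x. inverse p ^ n * x) ` {x::'f. av x \<le> 1}" by blast
  qed
  ultimately show ?thesis using closed_av_le[of c]
    by (metis Int_absorb2 closed_Int_compact)
qed

text \<open>A bounded sequence lies in a compact ball around 0. The property passes to matrices,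
  where it makes the congruence subgroups compact.\<close>

instance nonarch_local_field \<subseteq> heine_borel
proof
  fix f :: "nat \<Rightarrow> 'a" assume "bounded (range f)"
  then obtain c where "\<And>n. av (f n) \<le> c" using bounded_any_center[of _ 0] unfolding av_def by (metis rangeI)
  then have "seq_compact {x::'a. av x \<le> c}" "\<forall>n. f n \<in> {x. av x \<le> c}"
    using compact_av_le compact_imp_seq_compact by auto
  then show "\<exists>l r. strict_mono r \<and> (f \<circ> r) \<longlonglongrightarrow> l"
    unfolding seq_compact_def by blast
qed

text \<open>The algebraic closure is then infinite too, so polynomial functions that agree off 0
  agree at 0.\<close>

lemma infinite_UNIV_local_field: "infinite (UNIV :: 'f::nonarch_local_field set)"
proof -
  obtain p :: 'f where p: "0 < av p" "av p < 1" by (rule uniformizer_exists) blast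
  have "inj (\<lambda>n. p ^ n)"
  proof (rule injI)
    fix m n assume "p ^ m = p ^ n"
    then have "av p ^ m = av p ^ n" by (simp flip: av_power)
    then show "m = n" using p by (metis less_irrefl linorder_neqE_nat power_strict_decreasing_iff)
  qed
  then show ?thesis using finite_subset range_inj_infinite subset_UNIV by metis
qed

section \<open>Matrices graded by orthogonal idempotents\<close>

lemma matrix_add_rdistrib: "(B + C) ** A = B ** A + C ** A"
  for A :: "'k::comm_ring_1 ^ 'n ^ 'm"
  by (simp add: vec_eq_iff matrix_matrix_mult_def sum.distrib distrib_right)

lemma matrix_sum_ldistrib: "A ** (\<Sum>i\<in>I. f i) = (\<Sum>i\<in>I. A ** f i)"
  for A :: "'k::comm_ring_1 ^ 'n ^ 'm"
  by (induction I rule: infinite_finite_induct) (simp_all add: matrix_add_ldistrib)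

lemma matrix_sum_rdistrib: "(\<Sum>i\<in>I. f i) ** A = (\<Sum>i\<in>I. f i ** A)"
  for A :: "'k::comm_ring_1 ^ 'n ^ 'm"
  by (induction I rule: infinite_finite_induct) (simp_all add: matrix_add_rdistrib)

lemma matrix_diff_ldistrib: "A ** (B - C) = A ** B - A ** C"
  for A :: "'k::comm_ring_1 ^ 'n ^ 'm"
  using matrix_add_ldistrib[of A "B - C" C] by (simp add: algebra_simps)

lemma matrix_diff_rdistrib: "(B - C) ** A = B ** A - C ** A"
  for A :: "'k::comm_ring_1 ^ 'n ^ 'm"
  using matrix_add_rdistrib[of "B - C" C A] by (simp add: algebra_simps)

lemma mat_mult_nth [simp]: "(mat c ** A) $ i $ j = c * A $ i $ j"
  for A :: "'k::comm_ring_1 ^ 'm ^ 'n"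
  by (simp add: matrix_matrix_mult_def mat_def if_distrib if_distribR cong: if_cong)

lemma mat_mult_commute: "A ** mat c = mat c ** A" for A :: "'k::comm_ring_1 ^ 'n ^ 'n"
  by (simp add: vec_eq_iff) (simp add: matrix_matrix_mult_def mat_def if_distrib if_distribR mult.commute cong: if_cong)

lemma mat_mult_mat [simp]: "mat c ** mat d = (mat (c * d) :: 'k::comm_ring_1 ^ 'n ^ 'n)"
  by (simp add: vec_eq_iff) (simp add: mat_def)

lemma matrix_mul_mat_left: "A ** (mat c ** B) = mat c ** (A ** B)" for A :: "'k::comm_ring_1 ^ 'n ^ 'n"
  by (metis mat_mult_commute matrix_mul_assoc)

lemma mat_mult_mat_left [simp]: "mat c ** (mat d ** A) = mat (c * d) ** A" for A :: "'k::comm_ring_1 ^ 'n ^ 'n"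
  by (simp add: matrix_mul_assoc)

lemma matrix_inv_cancel:
  assumes "invertible A"
  shows "A ** matrix_inv A = mat 1" "matrix_inv A ** A = mat 1"
proof -
  have "\<exists>B. A ** B = mat 1 \<and> B ** A = mat 1" using assms by (simp add: invertible_def)
  then have "A ** matrix_inv A = mat 1 \<and> matrix_inv A ** A = mat 1"
    unfolding matrix_inv_def by (rule someI_ex)
  then show "A ** matrix_inv A = mat 1" "matrix_inv A ** A = mat 1" by auto
qed

lemma invertibleI: "A ** B = mat 1 \<Longrightarrow> invertible A" for A :: "'k::field ^ 'n ^ 'n"
  using invertible_right_inverse by blast

lemma matrix_inv_unique: "A ** B = mat 1 \<Longrightarrow> matrix_inv A = B" for A :: "'k::field ^ 'n ^ 'n"
  by (metis invertibleI matrix_inv_cancel(2) matrix_mul_assoc matrix_mul_lid matrix_mul_rid)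

lemma matrix_group_closed:
  assumes "matrix_group H"
  shows "mat 1 \<in> H" "A \<in> H \<Longrightarrow> B \<in> H \<Longrightarrow> A ** B \<in> H" "A \<in> H \<Longrightarrow> matrix_inv A \<in> H"
    "A \<in> H \<Longrightarrow> A ** matrix_inv A = mat 1" "A \<in> H \<Longrightarrow> matrix_inv A ** A = mat 1"
  using assms unfolding matrix_group_def GL_def by (auto simp: matrix_inv_cancel subset_iff)

section \<open>Block (Peirce) decomposition and the pattern attached to a weight function\<close>

locale idempotents =
  fixes I :: "'i set" and E :: "'i \<Rightarrow> 'k::field ^ 'n ^ 'n"
  assumes finite_I: "finite I"
    and orthogonal: "i \<in> I \<Longrightarrow> j \<in> I \<Longrightarrow> E i ** E j = (if i = j then E i else 0)"
    and sum_E: "(\<Sum>i\<in>I. E i) = mat 1"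
begin

definition block :: "'i \<Rightarrow> 'i \<Rightarrow> 'k ^ 'n ^ 'n \<Rightarrow> 'k ^ 'n ^ 'n" where
  "block i j A = E i ** A ** E j"

lemma block_add: "block i j (A + B) = block i j A + block i j B"
  and block_diff: "block i j (A - B) = block i j A - block i j B"
  and block_0: "block i j 0 = 0"
  and block_scale: "block i j (mat c ** A) = mat c ** block i j A"
  by (simp_all add: block_def matrix_add_ldistrib matrix_add_rdistrib matrix_diff_ldistrib
      matrix_diff_rdistrib matrix_mul_mat_left flip: matrix_mul_assoc)

lemma block_sum: "block i j (\<Sum>x\<in>J. f x) = (\<Sum>x\<in>J. block i j (f x))"
  by (induction J rule: infinite_finite_induct) (simp_all add: block_add block_0)

lemma block_expand: "A = (\<Sum>i\<in>I. \<Sum>j\<in>I. block i j A)"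
proof -
  have "A = (\<Sum>i\<in>I. E i) ** A ** (\<Sum>j\<in>I. E j)" by (simp add: sum_E)
  also have "\<dots> = (\<Sum>i\<in>I. \<Sum>j\<in>I. block i j A)"
    unfolding matrix_sum_rdistrib matrix_sum_ldistrib block_def by (rule sum.swap)
  finally show ?thesis .
qed

lemma block_eqI: "(\<And>i j. i \<in> I \<Longrightarrow> j \<in> I \<Longrightarrow> block i j A = block i j B) \<Longrightarrow> A = B"
  by (subst (1 2) block_expand) (simp cong: sum.cong)

lemma block_mult: "block i j (A ** B) = (\<Sum>l\<in>I. block i l A ** block l j B)"
proof -
  have "block i j (A ** B) = E i ** A ** (\<Sum>l\<in>I. E l) ** B ** E j"
    by (simp add: sum_E block_def matrix_mul_assoc)
  also have "\<dots> = E i ** A ** (\<Sum>l\<in>I. E l ** E l) ** B ** E j"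
    by (simp add: orthogonal)
  also have "\<dots> = (\<Sum>l\<in>I. block i l A ** block l j B)"
    by (simp only: matrix_sum_rdistrib matrix_sum_ldistrib block_def matrix_mul_assoc)
  finally show ?thesis .
qed

lemma block_block:
  assumes "i \<in> I" "j \<in> I" "k \<in> I" "l \<in> I"
  shows "block i j (block k l A) = (if i = k \<and> j = l then block i j A else 0)"
proof -
  have "block i j (block k l A) = (E i ** E k) ** A ** (E l ** E j)"
    by (simp add: block_def matrix_mul_assoc)
  then show ?thesis using assms by (auto simp: orthogonal block_def)
qed

lemma block_one: "i \<in> I \<Longrightarrow> j \<in> I \<Longrightarrow> block i j (mat 1) = (if i = j then E i else 0)"
  by (simp add: block_def orthogonal)

text \<open>Serves to evaluate matrices given by rescaled blocks, such as \<open>part0\<close> and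
  \<open>cochar_path\<close>.\<close>

lemma block_double_sum:
  assumes "i \<in> I" "j \<in> I"
  shows "block i j (\<Sum>a\<in>I. \<Sum>b\<in>I. mat (c a b) ** block a b A) = mat (c i j) ** block i j A"
proof -
  have "block i j (\<Sum>a\<in>I. \<Sum>b\<in>I. mat (c a b) ** block a b A)
      = (\<Sum>a\<in>I. \<Sum>b\<in>I. if b = j then (if a = i then mat (c a b) ** block a b A else 0) else 0)"
    using assms by (auto simp: block_sum block_scale block_block intro!: sum.cong)
  then show ?thesis using assms finite_I by (simp add: sum.delta)
qed

definition diag :: "('i \<Rightarrow> int) \<Rightarrow> 'k \<Rightarrow> 'k ^ 'n ^ 'n" where
  "diag k t = (\<Sum>i\<in>I. mat (t powi k i) ** E i)"

lemma E_diag: "i \<in> I \<Longrightarrow> E i ** diag k t = mat (t powi k i) ** E i"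
  and diag_E: "i \<in> I \<Longrightarrow> diag k t ** E i = mat (t powi k i) ** E i"
proof -
  assume i: "i \<in> I"
  have "E i ** diag k t = (\<Sum>j\<in>I. if j = i then mat (t powi k j) ** E j else 0)"
    using i by (auto simp: diag_def matrix_sum_ldistrib matrix_mul_mat_left orthogonal intro!: sum.cong)
  then show "E i ** diag k t = mat (t powi k i) ** E i" using i finite_I by simp
  have "diag k t ** E i = (\<Sum>j\<in>I. if j = i then mat (t powi k j) ** E j else 0)"
    using i by (auto simp: diag_def matrix_sum_rdistrib orthogonal simp flip: matrix_mul_assoc intro!: sum.cong)
  then show "diag k t ** E i = mat (t powi k i) ** E i" using i finite_I by simp
qed

lemma block_conj:
  assumes "i \<in> I" "j \<in> I" "t \<noteq> 0"
  shows "block i j (diag k t ** A ** diag (\<lambda>i. - k i) t) = mat (t powi (k i - k j)) ** block i j A"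
proof -
  have "block i j (diag k t ** A ** diag (\<lambda>i. - k i) t) = (E i ** diag k t) ** A ** (diag (\<lambda>i. - k i) t ** E j)"
    by (simp add: block_def matrix_mul_assoc)
  also have "\<dots> = mat (t powi k i) ** (E i ** A ** (mat (t powi (- k j)) ** E j))"
    by (simp only: E_diag[OF assms(1)] diag_E[OF assms(2)] matrix_mul_assoc)
  also have "\<dots> = mat (t powi k i * t powi (- k j)) ** block i j A"
    by (simp only: matrix_mul_mat_left[of "E i ** A"] mat_mult_mat_left block_def)
  also have "t powi k i * t powi (- k j) = t powi (k i - k j)"
    using power_int_add[of t "k i" "- k j"] assms(3) by simp
  finally show ?thesis .
qed

lemma diag_mult_diag_minus: "t \<noteq> 0 \<Longrightarrow> diag k t ** diag (\<lambda>i. - k i) t = mat 1"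
proof (rule block_eqI)
  fix i j assume "t \<noteq> 0" "i \<in> I" "j \<in> I"
  then show "block i j (diag k t ** diag (\<lambda>i. - k i) t) = block i j (mat 1)"
    using block_conj[of i j t k "mat 1"] by (auto simp: block_one)
qed

lemma matrix_inv_diag: "t \<noteq> 0 \<Longrightarrow> matrix_inv (diag k t) = diag (\<lambda>i. - k i) t"
  by (rule matrix_inv_unique) (rule diag_mult_diag_minus)

text \<open>Conjugation by \<open>diag k t\<close> multiplies block \<open>(i, j)\<close> by the
  power of \<open>t\<close> with exponent \<open>k i - k j\<close>. The blocks required to vanish
  are those that would have a pole at \<open>t = 0\<close>, so this is membership in
  \<open>P\<close>.\<close>

definition upper :: "('i \<Rightarrow> int) \<Rightarrow> 'k ^ 'n ^ 'n \<Rightarrow> bool" where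
  "upper k A \<longleftrightarrow> (\<forall>i\<in>I. \<forall>j\<in>I. k i < k j \<longrightarrow> block i j A = 0)"

text \<open>For \<open>upper\<close> matrices this is the limit at \<open>t = 0\<close> of the
  conjugates: blocks of positive exponent die, those of exponent 0 survive.\<close>

definition part0 :: "('i \<Rightarrow> int) \<Rightarrow> 'k ^ 'n ^ 'n \<Rightarrow> 'k ^ 'n ^ 'n" where
  "part0 k A = (\<Sum>i\<in>I. \<Sum>j\<in>I. mat (if k i = k j then 1 else 0) ** block i j A)"

lemma block_part0:
  "i \<in> I \<Longrightarrow> j \<in> I \<Longrightarrow> block i j (part0 k A) = (if k i = k j then block i j A else 0)"
  by (simp add: part0_def block_double_sum)

lemma part0_minus: "part0 (\<lambda>i. - k i) A = part0 k A"
  by (simp add: part0_def)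

lemma part0_one: "part0 k (mat 1) = mat 1"
  by (rule block_eqI) (auto simp: block_part0 block_one)

lemma upper_part0: "upper k (part0 k A)"
  by (auto simp: upper_def block_part0)

lemma upper_minus_part0: "upper (\<lambda>i. - k i) (part0 k A)"
  by (auto simp: upper_def block_part0)

lemma part0_eq_self: "upper k A \<Longrightarrow> upper (\<lambda>i. - k i) A \<Longrightarrow> part0 k A = A"
  by (rule block_eqI) (force simp: block_part0 upper_def)

lemma upper_mult:
  assumes "upper k A" "upper k B"
  shows "upper k (A ** B)"
  unfolding upper_def block_mult
proof (intro ballI impI sum.neutral)
  fix i j l assume "i \<in> I" "j \<in> I" "k i < k j" "l \<in> I"
  then show "block i l A ** block l j B = 0"
    using assms by (cases "k i < k l") (auto simp: upper_def)
qed

text \<open>Let \<open>k i = k j\<close>. An intermediate index \<open>l\<close> with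
  \<open>k l > k i\<close> meets a zero block of \<open>A\<close>, one with \<open>k l < k i\<close>
  a zero block of \<open>B\<close>, so only indices of the same weight contribute.\<close>

lemma part0_mult:
  assumes "upper k A" "upper k B"
  shows "part0 k (A ** B) = part0 k A ** part0 k B"
proof (rule block_eqI)
  fix i j assume ij: "i \<in> I" "j \<in> I"
  have "(if k i = k j then block i l A ** block l j B else 0) = block i l (part0 k A) ** block l j (part0 k B)"
    if "l \<in> I" for l
    using assms ij that unfolding upper_def
    by (cases "k i" "k l" rule: linorder_cases) (auto simp: block_part0)
  then show "block i j (part0 k (A ** B)) = block i j (part0 k A ** part0 k B)"
    using ij by (auto simp: block_part0 block_mult intro!: sum.cong sum.neutral[symmetric] cong: if_cong)
qed

end

lemma continuous_on_mult_av [continuous_intros]: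
  fixes f g :: "'b::topological_space \<Rightarrow> 'f::nonarch_local_field"
  shows "continuous_on S f \<Longrightarrow> continuous_on S g \<Longrightarrow> continuous_on S (\<lambda>x. f x * g x)"
  unfolding continuous_on_def by (auto intro: tendsto_mult)

lemma continuous_on_prod_av [continuous_intros]:
  fixes f :: "'i \<Rightarrow> 'b::topological_space \<Rightarrow> 'f::nonarch_local_field"
  shows "(\<And>i. i \<in> J \<Longrightarrow> continuous_on S (f i)) \<Longrightarrow> continuous_on S (\<lambda>x. \<Prod>i\<in>J. f i x)"
  by (induction J rule: infinite_finite_induct) (auto intro!: continuous_intros)

lemma continuous_on_matrix_mult [continuous_intros]:
  fixes f :: "'b::topological_space \<Rightarrow> 'f::nonarch_local_field ^ 'n ^ 'm" and g :: "'b \<Rightarrow> 'f ^ 'l ^ 'n"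
  shows "continuous_on S f \<Longrightarrow> continuous_on S g \<Longrightarrow> continuous_on S (\<lambda>x. f x ** g x)"
  unfolding matrix_matrix_mult_def by (intro continuous_intros)

lemma continuous_on_det [continuous_intros]:
  fixes f :: "'b::topological_space \<Rightarrow> 'f::nonarch_local_field ^ 'n ^ 'n"
  shows "continuous_on S f \<Longrightarrow> continuous_on S (\<lambda>x. det (f x))"
  unfolding det_def by (intro continuous_intros)

section \<open>Decomposing elements of a compact open subgroup along an automorphism\<close>

text \<open>
  The tidying argument of Willis: the sets \<open>C n\<close> decrease to \<open>V\<^sub>+ = {h. \<forall>n. \<alpha>\<^sup>n h \<in> V}\<close>, so by compactness some
  \<open>C N\<close> lies in its open neighbourhood \<open>V\<^sub>+ (V \<inter> \<alpha> V)\<close>. Writing \<open>h = p \<alpha>(h')\<close> accordingly, \<open>h'\<close> is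
  again in \<open>C N\<close>; iterating pushes the second factor towards \<open>V\<^sub>- = {h. \<forall>n. \<alpha>\<^sup>-\<^sup>n h \<in> V}\<close>.
\<close>

lemma tidy_decomposition:
  fixes V :: "('f::nonarch_local_field ^ 'n ^ 'n) set"
  assumes compact: "compact V" and group: "matrix_group V"
    and hom: "\<And>A B. \<alpha> (A ** B) = \<alpha> A ** \<alpha> B" and one: "\<alpha> (mat 1) = mat 1"
    and inv: "\<And>A. \<beta> (\<alpha> A) = A" "\<And>A. \<alpha> (\<beta> A) = A"
    and cont: "continuous_on UNIV \<alpha>" "continuous_on UNIV \<beta>"
    and "open": "openin (top_of_set V) {h \<in> V. \<beta> h \<in> V}"
  obtains N :: nat where
    "\<And>h. (\<And>n. n \<le> N \<Longrightarrow> (\<alpha> ^^ n) h \<in> V) \<Longrightarrow>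
      \<exists>q x. h = q ** x \<and> (\<forall>n. (\<alpha> ^^ n) q \<in> V) \<and> (\<forall>n. (\<beta> ^^ n) x \<in> V)"
proof -
  note [simp] = matrix_group_closed[OF group]
  have closed: "closed V" using compact by (rule compact_imp_closed)
  have contn: "continuous_on UNIV (\<alpha> ^^ n)" "continuous_on UNIV (\<beta> ^^ n)" for n
  proof -
    show "continuous_on UNIV (\<alpha> ^^ n)"
      by (induction n) (auto intro: continuous_on_compose2[OF cont(1)] simp: continuous_on_id id_def comp_def)
    show "continuous_on UNIV (\<beta> ^^ n)"
      by (induction n) (auto intro: continuous_on_compose2[OF cont(2)] simp: continuous_on_id id_def comp_def)
  qed
  have homn: "(\<alpha> ^^ n) (A ** B) = (\<alpha> ^^ n) A ** (\<alpha> ^^ n) B" for n A B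
    by (induction n) (simp_all add: hom)
  have onen: "(\<alpha> ^^ n) (mat 1) = mat 1" for n
    by (induction n) (simp_all add: one)
  have invn: "(\<alpha> ^^ n) (matrix_inv A) = matrix_inv ((\<alpha> ^^ n) A)" if "A \<in> V" for n A
  proof -
    have "(\<alpha> ^^ n) A ** (\<alpha> ^^ n) (matrix_inv A) = (\<alpha> ^^ n) (A ** matrix_inv A)" by (simp add: homn)
    also have "\<dots> = mat 1" using that by (simp add: onen)
    finally show ?thesis by (metis matrix_inv_unique)
  qed
  define Vp where "Vp = {h. \<forall>n. (\<alpha> ^^ n) h \<in> V}"
  define C where "C n = {h. \<forall>k\<le>n. (\<alpha> ^^ k) h \<in> V}" for n
  have VpV: "q \<in> Vp \<Longrightarrow> q \<in> V" for q by (auto simp: Vp_def dest: spec[of _ 0])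
  have CV: "q \<in> C n \<Longrightarrow> q \<in> V" for q n by (auto simp: C_def dest: spec[of _ 0])
  have Vp_inv: "matrix_inv q \<in> Vp" if "q \<in> Vp" for q
    using that VpV[OF that] by (auto simp: Vp_def invn)
  have Vp_alpha: "\<alpha> q \<in> Vp" if "q \<in> Vp" for q
    using that unfolding Vp_def by (auto simp: funpow_swap1 dest: spec[of _ "Suc _"])
  have Vp_mult: "q ** q' \<in> Vp" if "q \<in> Vp" "q' \<in> Vp" for q q'
    using that by (auto simp: Vp_def homn)
  have cl: "closed {h. f h \<in> V}" if "continuous_on UNIV f" for f :: "'f ^ 'n ^ 'n \<Rightarrow> 'f ^ 'n ^ 'n"
    using closed_vimage[OF closed that] by (simp add: vimage_def)
  have closedC: "closed (C n)" for n
    unfolding C_def by (intro closed_Collect_all closed_Collect_imp cl contn) auto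
  have closedVp: "closed Vp"
    unfolding Vp_def by (intro closed_Collect_all cl contn)
  have compactC: "compact (C n)" for n
    using closed_Int_compact[OF closedC[of n] compact] CV[of _ n]
    by (metis Int_absorb2 subsetI)
  have compactVp: "compact Vp"
    using closed_Int_compact[OF closedVp compact] VpV
    by (metis Int_absorb2 subsetI)

  \<comment> \<open>The set on the left is the intersection of \<open>V\<close> and
    \<open>\<alpha> V\<close>.\<close>
  obtain W where W: "open W" "{h \<in> V. \<beta> h \<in> V} = V \<inter> W"
    using "open" by (auto simp: openin_open)
  define Y where "Y = (\<Union>p\<in>Vp. {h. matrix_inv p ** h \<in> W})"
  have openY: "open Y"
  proof -
    have "continuous_on UNIV (\<lambda>h :: 'f ^ 'n ^ 'n. matrix_inv p ** h)" for p :: "'f ^ 'n ^ 'n"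
      by (intro continuous_intros)
    then have "open {h :: 'f ^ 'n ^ 'n. matrix_inv p ** h \<in> W}" for p :: "'f ^ 'n ^ 'n"
      using open_vimage[OF W(1), of "\<lambda>h :: 'f ^ 'n ^ 'n. matrix_inv p ** h"] by (simp add: vimage_def)
    then show ?thesis unfolding Y_def by blast
  qed
  have VpY: "Vp \<subseteq> Y"
  proof
    fix p assume p: "p \<in> Vp"
    have "\<beta> (mat 1) = mat 1" using inv(1)[of "mat 1"] by (simp add: one)
    then have "mat 1 \<in> {h \<in> V. \<beta> h \<in> V}" by simp
    then have "mat 1 \<in> W" unfolding W(2) by simp
    then show "p \<in> Y" using p VpV[OF p] by (auto simp: Y_def intro!: bexI[of _ p])
  qed
  \<comment> \<open>Otherwise the decreasing nonempty compact sets \<open>C n - Y\<close> have a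
    common point. It lies in every \<open>C n\<close>, hence in \<open>Vp\<close>, hence in
    \<open>Y\<close>.\<close>
  have "\<exists>N. C N \<subseteq> Y"
  proof (rule ccontr)
    assume "\<nexists>N. C N \<subseteq> Y"
    then have "\<Inter> (range (\<lambda>n. C n - Y)) \<noteq> {}"
      by (intro compact_nest compact_diff compactC openY) (auto simp: C_def)
    moreover have "(\<Inter>n. C n) \<subseteq> Vp" by (auto simp: C_def Vp_def)
    ultimately show False using VpY by blast
  qed
  then obtain N where N: "C N \<subseteq> Y" ..
  have step: "\<exists>p h'. p \<in> Vp \<and> h' \<in> C N \<and> h = p ** \<alpha> h'" if h: "h \<in> C N" for h
  proof -
    obtain p where p: "p \<in> Vp" "matrix_inv p ** h \<in> W" using N h by (auto simp: Y_def)
    let ?g = "matrix_inv p ** h"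
    have pV: "p \<in> V" and "h \<in> V" using p h VpV CV by auto
    then have "?g \<in> V" by simp
    then have "?g \<in> {h \<in> V. \<beta> h \<in> V}" unfolding W(2) using p by simp
    then have \<beta>: "\<beta> ?g \<in> V" by simp
    have "(\<alpha> ^^ k) ?g \<in> V" if "k \<le> N" for k
      using that h p(1) pV by (auto simp: homn invn C_def Vp_def)
    \<comment> \<open>Exponent \<open>k + 1\<close> on \<open>\<beta> ?g\<close> is exponent
      \<open>k\<close> on \<open>?g\<close>, and exponent 0 is the condition cut out by
      \<open>W\<close>. So \<open>\<beta> ?g\<close> satisfies the condition with the same
      \<open>N\<close>, which allows the step to be repeated.\<close>
    then have "(\<alpha> ^^ k) (\<beta> ?g) \<in> V" if "k \<le> N" for k
      using that \<beta> by (cases k) (auto simp: funpow_swap1 inv)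
    then have "\<beta> ?g \<in> C N" by (simp add: C_def)
    moreover have "h = p ** \<alpha> (\<beta> ?g)" using pV by (simp add: inv matrix_mul_assoc)
    ultimately show ?thesis using p by blast
  qed
  have fin: "\<exists>q x. h = q ** x \<and> q \<in> Vp \<and> (\<forall>k\<le>n. (\<beta> ^^ k) x \<in> V)" if "h \<in> C N" for h n
    using that
  proof (induction n arbitrary: h)
    case 0
    then show ?case using CV[OF 0]
      by (intro exI[of _ "mat 1"] exI[of _ h]) (auto simp: Vp_def onen)
  next
    case (Suc n)
    obtain p h' where p: "p \<in> Vp" "h' \<in> C N" "h = p ** \<alpha> h'" using step Suc.prems by blast
    obtain q x where q: "h' = q ** x" "q \<in> Vp" "\<And>k. k \<le> n \<Longrightarrow> (\<beta> ^^ k) x \<in> V"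
      using Suc.IH[OF p(2)] by blast
    \<comment> \<open>\<open>Vp\<close> is stable under \<open>\<alpha>\<close> and products. The
      right factor \<open>\<alpha> x\<close> lies in \<open>V\<close> as a quotient of elements of
      \<open>V\<close>, and it has one more backward iterate in \<open>V\<close> than
      \<open>x\<close>.\<close>
    have q': "p ** \<alpha> q \<in> Vp" using p q by (simp add: Vp_mult Vp_alpha)
    have h: "h = (p ** \<alpha> q) ** \<alpha> x" using p q by (simp add: hom matrix_mul_assoc)
    have "matrix_inv (p ** \<alpha> q) ** h = (matrix_inv (p ** \<alpha> q) ** (p ** \<alpha> q)) ** \<alpha> x"
      unfolding h by (rule matrix_mul_assoc)
    then have "\<alpha> x = matrix_inv (p ** \<alpha> q) ** h" using VpV[OF q'] by simp
    then have "\<alpha> x \<in> V" using VpV[OF q'] CV[OF Suc.prems] by simp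
    then have "(\<beta> ^^ k) (\<alpha> x) \<in> V" if "k \<le> Suc n" for k
      using that q(3) by (cases k) (auto simp: funpow_swap1 inv)
    then show ?case using h q' by blast
  qed
  have "\<exists>q x. h = q ** x \<and> (\<forall>n. (\<alpha> ^^ n) q \<in> V) \<and> (\<forall>n. (\<beta> ^^ n) x \<in> V)" if h: "h \<in> C N" for h
  proof -
    \<comment> \<open>The factors from \<open>fin\<close> may vary with \<open>n\<close>. A pair
      that serves all \<open>n\<close> is a common point of these decreasing compact sets.\<close>
    define Q where "Q n = (Vp \<times> V) \<inter> {z. fst z ** snd z = h} \<inter> {z. \<forall>k\<le>n. (\<beta> ^^ k) (snd z) \<in> V}" for n
    have "closed {z. fst z ** snd z = h}"
      by (intro closed_Collect_eq continuous_intros)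
    moreover have "closed {z::('f^'n^'n) \<times> ('f^'n^'n). \<forall>k\<le>n. (\<beta> ^^ k) (snd z) \<in> V}" for n
    proof -
      have "closed {z::('f^'n^'n) \<times> ('f^'n^'n). (\<beta> ^^ k) (snd z) \<in> V}" for k
        using closed_vimage[OF closed continuous_on_compose2[OF contn(2)[of k] continuous_on_snd[OF continuous_on_id]]]
        by (simp add: vimage_def)
      then show ?thesis by (intro closed_Collect_all closed_Collect_imp) auto
    qed
    ultimately have "compact (Q n)" for n
      unfolding Q_def by (intro compact_Int_closed compact_Times compactVp compact)
    moreover have "Q n \<noteq> {}" for n
      using fin[OF h, of n] unfolding Q_def by (force dest: spec[of _ 0])
    moreover have "Q n \<subseteq> Q m" if "m \<le> n" for m n using that by (auto simp: Q_def)
    ultimately have "\<Inter> (range Q) \<noteq> {}" by (intro compact_nest)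
    then obtain q x where "\<And>n. (q, x) \<in> Q n" by auto
    then have "h = q ** x" "q \<in> Vp" "\<And>n. (\<beta> ^^ n) x \<in> V" by (auto simp: Q_def)
    then show ?thesis unfolding Vp_def by blast
  qed
  then show ?thesis using that[of N] by (simp add: C_def)
qed

section \<open>Congruence subgroups\<close>

definition bounded_by :: "real \<Rightarrow> 'f::nonarch_local_field ^ 'n ^ 'm \<Rightarrow> bool" where
  "bounded_by d A \<longleftrightarrow> (\<forall>i j. av (A $ i $ j) \<le> d)"

text \<open>The ultrametric inequality leaves no factor counting summands; this is why matrices
  close to 1 form groups.\<close>

lemma bounded_by_mult:
  "bounded_by c A \<Longrightarrow> bounded_by d B \<Longrightarrow> 0 \<le> c \<Longrightarrow> 0 \<le> d \<Longrightarrow> bounded_by (c * d) (A ** B)"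
  by (auto simp: bounded_by_def matrix_matrix_mult_def av_mult intro!: av_sum_le mult_mono)

lemma bounded_by_sum: "(\<And>i. i \<in> J \<Longrightarrow> bounded_by d (f i)) \<Longrightarrow> 0 \<le> d \<Longrightarrow> bounded_by d (\<Sum>i\<in>J. f i)"
  by (auto simp: bounded_by_def intro!: av_sum_le)

lemma bounded_by_add: "bounded_by d A \<Longrightarrow> bounded_by d B \<Longrightarrow> bounded_by d (A + B)"
  and bounded_by_diff: "bounded_by d A \<Longrightarrow> bounded_by d B \<Longrightarrow> bounded_by d (A - B)"
  by (auto simp: bounded_by_def intro!: av_add_le av_diff_le)

lemma bounded_by_exists: "\<exists>c>0. bounded_by c A"
proof -
  define c where "c = 1 + (\<Sum>i\<in>UNIV. \<Sum>j\<in>UNIV. av (A $ i $ j))"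
  have "av (A $ i $ j) \<le> c" for i j
  proof -
    have "av (A $ i $ j) \<le> (\<Sum>j\<in>UNIV. av (A $ i $ j))"
      by (rule member_le_sum) auto
    also have "\<dots> \<le> (\<Sum>i\<in>UNIV. \<Sum>j\<in>UNIV. av (A $ i $ j))"
      by (rule member_le_sum[of i UNIV "\<lambda>i. \<Sum>j\<in>UNIV. av (A $ i $ j)"]) (auto intro: sum_nonneg)
    finally show ?thesis by (simp add: c_def)
  qed
  moreover have "c > 0" unfolding c_def by (intro add_pos_nonneg sum_nonneg) auto
  ultimately show ?thesis by (auto simp: bounded_by_def)
qed

lemma bounded_by_mat: "bounded_by d A \<Longrightarrow> av c \<le> 1 \<Longrightarrow> bounded_by d (mat c ** A)"
  by (auto simp: bounded_by_def av_mult intro: order_trans[OF mult_left_le_one_le])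

lemma invertible_of_close_to_one:
  fixes A :: "'f::nonarch_local_field ^ 'n ^ 'n"
  assumes "bounded_by d (A - mat 1)" "d < 1"
  shows "invertible A"
proof -
  have "x = 0" if "A *v x = 0" for x
  proof -
    \<comment> \<open>Choose a coordinate of maximal size. A kernel vector satisfies
      \<open>x = (mat 1 - A) *v x\<close>, so this size is at most \<open>d < 1\<close> times
      itself.\<close>
    have "finite (range (\<lambda>i. av (x $ i)))" by simp
    then obtain i where i: "\<And>j. av (x $ j) \<le> av (x $ i)"
      using Max_ge[of "range (\<lambda>i. av (x $ i))"] Max_in[of "range (\<lambda>i. av (x $ i))"] by fastforce
    have d: "0 \<le> d" using assms(1) unfolding bounded_by_def by (meson av_nonneg order_trans)
    have "x $ i = (A *v x) $ i - ((A - mat 1) *v x) $ i"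
      by (simp add: matrix_vector_mult_diff_rdistrib)
    also have "\<dots> = - (\<Sum>j\<in>UNIV. (A - mat 1) $ i $ j * x $ j)"
      using that by (simp add: matrix_vector_mult_def)
    finally have "av (x $ i) = av (\<Sum>j\<in>UNIV. (A - mat 1) $ i $ j * x $ j)" by simp
    also have "\<dots> \<le> d * av (x $ i)"
      using assms i d unfolding bounded_by_def av_mult
      by (intro av_sum_le) (auto simp: av_mult intro!: mult_mono)
    finally have "(1 - d) * av (x $ i) \<le> 0" by (simp add: left_diff_distrib)
    then have "av (x $ i) = 0" using assms(2) av_nonneg[of "x $ i"] by (simp add: mult_le_0_iff)
    then have "av (x $ j) = 0" for j using i[of j] av_nonneg[of "x $ j"] by simp
    then show ?thesis by (simp add: vec_eq_iff)
  qed
  then show ?thesis unfolding invertible_left_inverse matrix_left_invertible_ker by blast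
qed

lemma bounded_vec_of_components:
  fixes B :: "'x::metric_space set"
  assumes "bounded B"
  shows "bounded {v :: 'x ^ 'n. \<forall>i. v $ i \<in> B}"
proof -
  obtain x e where e: "\<And>y. y \<in> B \<Longrightarrow> dist x y \<le> e" using assms by (auto simp: bounded_def)
  have "dist (\<chi> i. x) v \<le> (\<Sum>i\<in>(UNIV::'n set). e)" if "\<forall>i. v $ i \<in> B" for v :: "'x ^ 'n"
  proof -
    have "dist (\<chi> i. x) v \<le> (\<Sum>i\<in>UNIV. dist x (v $ i))"
      unfolding dist_vec_def by (rule order_trans[OF L2_set_le_sum]) auto
    also have "\<dots> \<le> (\<Sum>i\<in>(UNIV::'n set). e)" using that e by (intro sum_mono) auto
    finally show ?thesis .
  qed
  then show ?thesis unfolding bounded_def by blast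
qed

section \<open>Congruence subgroups measured block by block\<close>

locale local_idempotents = idempotents I E
  for I :: "'i set" and E :: "'i \<Rightarrow> 'f::nonarch_local_field ^ 'n ^ 'n"
begin

definition small :: "real \<Rightarrow> 'f ^ 'n ^ 'n \<Rightarrow> bool" where
  "small d A \<longleftrightarrow> (\<forall>i\<in>I. \<forall>j\<in>I. bounded_by d (block i j A))"

definition congruence :: "real \<Rightarrow> ('f ^ 'n ^ 'n) set" where
  "congruence d = {A. small d (A - mat 1)}"

lemma small_mono: "small c A \<Longrightarrow> c \<le> d \<Longrightarrow> small d A"
  unfolding small_def bounded_by_def by (meson order_trans)

lemma congruence_mono: "c \<le> d \<Longrightarrow> congruence c \<subseteq> congruence d"
  by (auto simp: congruence_def intro: small_mono)

lemma small_add: "small d A \<Longrightarrow> small d B \<Longrightarrow> small d (A + B)"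
  and small_diff: "small d A \<Longrightarrow> small d B \<Longrightarrow> small d (A - B)"
  by (auto simp: small_def block_add block_diff intro: bounded_by_add bounded_by_diff)

lemma small_mult: "small c A \<Longrightarrow> small d B \<Longrightarrow> 0 \<le> c \<Longrightarrow> 0 \<le> d \<Longrightarrow> small (c * d) (A ** B)"
  by (auto simp: small_def block_mult intro!: bounded_by_sum bounded_by_mult)

lemma bounded_by_of_small: "small d A \<Longrightarrow> 0 \<le> d \<Longrightarrow> bounded_by d A"
  by (subst block_expand) (auto simp: small_def intro!: bounded_by_sum)

lemma small_exists: "\<exists>c>0. small c A"
proof -
  have "\<exists>c. \<forall>i j. c i j > 0 \<and> bounded_by (c i j) (block i j A)"
  proof -
    have "\<forall>i j. \<exists>c. c > 0 \<and> bounded_by c (block i j A)" using bounded_by_exists by blast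
    then show ?thesis by metis
  qed
  then obtain c where c: "\<And>i j. c i j > 0" "\<And>i j. bounded_by (c i j) (block i j A)" by blast
  define s where "s = 1 + (\<Sum>i\<in>I. \<Sum>j\<in>I. c i j)"
  have "c i j \<le> s" if "i \<in> I" "j \<in> I" for i j
  proof -
    have "c i j \<le> (\<Sum>j\<in>I. c i j)"
      using that finite_I c(1) by (intro member_le_sum) (auto simp: less_imp_le)
    also have "\<dots> \<le> (\<Sum>i\<in>I. \<Sum>j\<in>I. c i j)"
      using that finite_I c(1)
      by (intro member_le_sum[of i I "\<lambda>i. \<Sum>j\<in>I. c i j"]) (auto intro: sum_nonneg simp: less_imp_le)
    finally show ?thesis by (simp add: s_def)
  qed
  then have "small s A" unfolding small_def bounded_by_def
    using c(2) unfolding bounded_by_def by (meson order_trans)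
  moreover have "s > 0" unfolding s_def using c(1) by (intro add_pos_nonneg sum_nonneg) (auto simp: less_imp_le)
  ultimately show ?thesis by blast
qed

lemma small_0: "0 \<le> d \<Longrightarrow> small d 0"
  by (simp add: small_def block_0 bounded_by_def)

lemma congruence_one: "0 \<le> d \<Longrightarrow> mat 1 \<in> congruence d"
  by (simp add: congruence_def small_0)

lemma congruence_invertible: "A \<in> congruence d \<Longrightarrow> 0 \<le> d \<Longrightarrow> d < 1 \<Longrightarrow> invertible A"
  unfolding congruence_def by (auto intro: invertible_of_close_to_one bounded_by_of_small)

lemma congruence_mult:
  assumes "A \<in> congruence d" "B \<in> congruence d" "0 \<le> d" "d \<le> 1"
  shows "A ** B \<in> congruence d"
proof -
  have "small (d * d) ((A - mat 1) ** (B - mat 1))"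
    using assms by (intro small_mult) (auto simp: congruence_def)
  then have "small d ((A - mat 1) ** (B - mat 1))"
    using assms by (elim small_mono) (simp add: mult_left_le)
  then have "small d ((A - mat 1) ** (B - mat 1) + (A - mat 1) + (B - mat 1))"
    using assms by (intro small_add) (auto simp: congruence_def)
  also have "(A - mat 1) ** (B - mat 1) + (A - mat 1) + (B - mat 1) = A ** B - mat 1"
    by (simp add: matrix_diff_ldistrib matrix_diff_rdistrib)
  finally show ?thesis by (simp add: congruence_def)
qed

text \<open>The deviation \<open>Y\<close> of the inverse from 1 satisfies
  \<open>Y = (mat 1 - A) ** Y + (mat 1 - A)\<close>. Substituting repeatedly improves any initial
  bound \<open>c\<close> to \<open>max d (d ^ n * c)\<close>, which is eventually
  \<open>d\<close>.\<close>

lemma congruence_inverse: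
  assumes A: "A \<in> congruence d" and d: "0 \<le> d" "d < 1"
  shows "matrix_inv A \<in> congruence d"
proof -
  define Y where "Y = matrix_inv A - mat 1"
  have "A ** matrix_inv A = mat 1" using A d congruence_invertible matrix_inv_cancel by blast
  then have Y: "Y = (mat 1 - A) ** Y + (mat 1 - A)"
    by (simp add: Y_def matrix_diff_ldistrib matrix_diff_rdistrib)
  have A': "small d (mat 1 - A)"
    using small_diff[OF small_0[OF d(1)], of "A - mat 1"] A by (simp add: congruence_def)
  obtain c where c: "c > 0" "small c Y" using small_exists by blast
  have "small (max d (d ^ n * c)) Y" for n
  proof (induction n)
    case 0
    then show ?case using c by (auto elim: small_mono)
  next
    case (Suc n)
    have "small (d * max d (d ^ n * c)) ((mat 1 - A) ** Y)"
      using A' Suc d c by (intro small_mult) auto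
    moreover have "d * max d (d ^ n * c) \<le> max d (d ^ Suc n * c)"
    proof -
      have "d * max d (d ^ n * c) = max (d * d) (d ^ Suc n * c)"
        using d by (simp add: max_mult_distrib_left mult.assoc)
      also have "\<dots> \<le> max d (d ^ Suc n * c)" using d by (intro max.mono) (simp_all add: mult_left_le)
      finally show ?thesis .
    qed
    ultimately have "small (max d (d ^ Suc n * c)) ((mat 1 - A) ** Y)" by (rule small_mono)
    moreover have "small (max d (d ^ Suc n * c)) (mat 1 - A)" using A' by (rule small_mono) simp
    ultimately show ?case by (subst Y) (rule small_add)
  qed
  moreover have "\<exists>n. d ^ n * c \<le> d"
  proof (cases "d = 0")
    case True
    then show ?thesis by (intro exI[of _ 1]) simp
  next
    case False
    then obtain n where "d ^ n < d / c" using real_arch_pow_inv[of "d / c" d] d c by auto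
    then show ?thesis using c by (intro exI[of _ n]) (simp add: field_simps)
  qed
  ultimately have "small d Y" by (metis max.absorb1)
  then show ?thesis by (simp add: congruence_def Y_def)
qed

lemma matrix_group_congruence: "0 \<le> d \<Longrightarrow> d < 1 \<Longrightarrow> matrix_group (congruence d)"
  unfolding matrix_group_def GL_def
  by (auto simp: congruence_one congruence_mult congruence_inverse intro: congruence_invertible)

text \<open>Finitely many preimages of a ball that is closed and, for positive radius, also open.
  Both topological properties are read off from this form.\<close>

lemma congruence_eq_Inter: "congruence d = (\<Inter>i\<in>I. \<Inter>j\<in>I. \<Inter>a. \<Inter>b. (\<lambda>A. block i j (A - mat 1) $ a $ b) -` {x. av x \<le> d})"
  by (auto simp: congruence_def small_def bounded_by_def)

lemma continuous_on_block: "continuous_on UNIV (\<lambda>A. block i j (A - mat 1) $ a $ b)"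
  unfolding block_diff vector_minus_component unfolding block_def by (intro continuous_intros)

lemma open_congruence: "0 < d \<Longrightarrow> open (congruence d)"
  unfolding congruence_eq_Inter using finite_I
  by (intro open_INT ballI open_vimage open_av_le continuous_on_block) auto

lemma closed_congruence: "closed (congruence d)"
  unfolding congruence_eq_Inter
  by (intro closed_INT ballI closed_vimage closed_av_le continuous_on_block)

lemma compact_congruence:
  assumes "0 \<le> d"
  shows "compact (congruence d)"
proof -
  have "bounded {x::'f. av x \<le> max 1 d}" by (intro compact_imp_bounded compact_av_le)
  then have "bounded {A::'f^'n^'n. \<forall>i. A $ i \<in> {v. \<forall>j. v $ j \<in> {x. av x \<le> max 1 d}}}"
    by (rule bounded_vec_of_components[OF bounded_vec_of_components])
  moreover have "congruence d \<subseteq> {A::'f^'n^'n. \<forall>i. A $ i \<in> {v. \<forall>j. v $ j \<in> {x. av x \<le> max 1 d}}}"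
  proof (intro subsetI, unfold mem_Collect_eq, intro allI)
    fix A i j assume "A \<in> congruence d"
    then have "av ((A - mat 1) $ i $ j) \<le> d"
      using bounded_by_of_small[of d "A - mat 1"] assms by (simp add: congruence_def bounded_by_def)
    then have "av ((A - mat 1) $ i $ j + mat 1 $ i $ j) \<le> max 1 d"
      by (intro av_add_le) (auto simp: mat_def)
    then show "av (A $ i $ j) \<le> max 1 d" by simp
  qed
  ultimately show ?thesis using closed_congruence bounded_subset compact_eq_bounded_closed by blast
qed

lemma congruence_subset_nhd:
  assumes "open T" "mat 1 \<in> T"
  shows "\<exists>d>0. congruence d \<subseteq> T"
proof -
  obtain e where e: "e > 0" "\<And>A. dist A (mat 1) < e \<Longrightarrow> A \<in> T" using assms unfolding open_dist by blast
  \<comment> \<open>The distance of matrices is at most the sum of the distances of all entries,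
    which then is at most \<open>e / 2\<close>.\<close>
  define d where "d = e / (2 * (real CARD('n) * real CARD('n)))"
  have n: "real CARD('n) > 0" by simp
  have d: "d > 0" using e by (simp add: d_def)
  have "dist A (mat 1) < e" if "A \<in> congruence d" for A :: "'f ^ 'n ^ 'n"
  proof -
    have *: "av ((A - mat 1) $ i $ j) \<le> d" for i j
      using that bounded_by_of_small[of d "A - mat 1"] d by (simp add: congruence_def bounded_by_def)
    have "dist A (mat 1) \<le> (\<Sum>i\<in>UNIV. dist (A $ i) (mat 1 $ i))"
      unfolding dist_vec_def[of A] by (rule L2_set_le_sum) auto
    also have "\<dots> \<le> (\<Sum>i\<in>(UNIV::'n set). \<Sum>j\<in>(UNIV::'n set). dist (A $ i $ j) (mat 1 $ i $ j))"
      unfolding dist_vec_def[of "A $ _"] by (intro sum_mono L2_set_le_sum) auto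
    also have "\<dots> \<le> (\<Sum>i\<in>(UNIV::'n set). \<Sum>j\<in>(UNIV::'n set). d)"
      using * by (intro sum_mono) (simp add: dist_eq_av)
    also have "\<dots> < e" using e n by (simp add: d_def)
    finally show ?thesis .
  qed
  then show ?thesis using d e by blast
qed

end

section \<open>Conjugation by cocharacters on blocks\<close>

context idempotents
begin

definition twist :: "'k \<Rightarrow> ('i \<Rightarrow> int) \<Rightarrow> 'k ^ 'n ^ 'n \<Rightarrow> 'k ^ 'n ^ 'n" where
  "twist t k A = diag k t ** A ** diag (\<lambda>i. - k i) t"

lemma block_twist:
  "i \<in> I \<Longrightarrow> j \<in> I \<Longrightarrow> t \<noteq> 0 \<Longrightarrow> block i j (twist t k A) = mat (t powi (k i - k j)) ** block i j A"
  unfolding twist_def by (rule block_conj)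

lemma twist_mult:
  assumes "t \<noteq> 0"
  shows "twist t k (A ** B) = twist t k A ** twist t k B"
proof -
  have "diag (\<lambda>i. - k i) t ** diag k t = mat 1"
    using diag_mult_diag_minus[of t "\<lambda>i. - k i"] assms by simp
  then have "A ** B = A ** (diag (\<lambda>i. - k i) t ** diag k t) ** B" by simp
  then show ?thesis by (simp add: twist_def matrix_mul_assoc)
qed

lemma twist_one: "t \<noteq> 0 \<Longrightarrow> twist t k (mat 1) = mat 1"
  by (simp add: twist_def diag_mult_diag_minus)

lemma twist_twist: "t \<noteq> 0 \<Longrightarrow> twist t k (twist t l A) = twist t (\<lambda>i. k i + l i) A"
  by (rule block_eqI) (simp add: block_twist add_diff_add power_int_add)

lemma twist_zero: "t \<noteq> 0 \<Longrightarrow> twist t (\<lambda>_. 0) A = A"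
  by (rule block_eqI) (simp add: block_twist)

text \<open>Iterates are again twists, so the orbit of a matrix is governed by explicit powers of
  \<open>t\<close> on each block.\<close>

lemma twist_funpow: "t \<noteq> 0 \<Longrightarrow> (twist t k ^^ n) A = twist t (\<lambda>i. int n * k i) A"
  by (induction n) (simp_all add: twist_zero twist_twist algebra_simps)

lemma twist_inverse:
  assumes "t \<noteq> 0" "invertible A"
  shows "twist t k (matrix_inv A) = matrix_inv (twist t k A)"
proof -
  have "twist t k A ** twist t k (matrix_inv A) = mat 1"
    using assms by (simp add: matrix_inv_cancel twist_one flip: twist_mult)
  then show ?thesis by (metis matrix_inv_unique)
qed

lemma twist_diff_one: "t \<noteq> 0 \<Longrightarrow> twist t k A - mat 1 = twist t k (A - mat 1)"
  using twist_one[of t k] unfolding twist_def by (simp add: matrix_diff_ldistrib matrix_diff_rdistrib)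

lemma part0_diff_one: "part0 k A - mat 1 = part0 k (A - mat 1)"
proof (rule block_eqI)
  fix i j assume "i \<in> I" "j \<in> I"
  then show "block i j (part0 k A - mat 1) = block i j (part0 k (A - mat 1))"
    by (auto simp: block_diff block_part0 block_one)
qed

text \<open>\<open>k i = k j\<close> is the failure of both strict inequalities, so the set of
  strictly ordered pairs determines everything.\<close>

lemma sign_pattern:
  assumes "{(i, j) \<in> I \<times> I. k i < k j} = {(i, j) \<in> I \<times> I. l i < l j}"
  shows "upper k = upper l" "upper (\<lambda>i. - k i) = upper (\<lambda>i. - l i)" "part0 k = part0 l"
proof -
  have *: "k i < k j \<longleftrightarrow> l i < l j" if "i \<in> I" "j \<in> I" for i j
    using assms that by blast
  show "upper k = upper l" "upper (\<lambda>i. - k i) = upper (\<lambda>i. - l i)"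
    by (auto simp: fun_eq_iff upper_def *)
  have "k i = k j \<longleftrightarrow> l i = l j" if "i \<in> I" "j \<in> I" for i j
    using *[OF that] *[OF that(2,1)] by auto
  then show "part0 k = part0 l"
    by (auto simp: fun_eq_iff part0_def intro!: sum.cong)
qed

end

context local_idempotents
begin

lemma continuous_on_twist: "continuous_on UNIV (twist t k)"
  unfolding twist_def[abs_def] by (intro continuous_intros)

lemma small_part0: "small d A \<Longrightarrow> 0 \<le> d \<Longrightarrow> small d (part0 k A)"
  by (auto simp: small_def block_part0 bounded_by_def)

lemma congruence_part0: "A \<in> congruence d \<Longrightarrow> 0 \<le> d \<Longrightarrow> part0 k A \<in> congruence d"
  by (auto simp: congruence_def part0_diff_one intro: small_part0)

text \<open>Conjugation contracts the blocks with \<open>k i > k j\<close> and expands those with \<open>k i < k j\<close>.\<close>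

lemma upper_iff_twist_bounded:
  assumes A: "A \<in> congruence d" and p: "p \<noteq> 0" "av p < 1" and d: "0 \<le> d"
  shows "upper k A \<longleftrightarrow> (\<forall>n. (twist p k ^^ n) A \<in> congruence d)"
proof
  assume up: "upper k A"
  have "small d (twist p (\<lambda>i. int n * k i) (A - mat 1))" for n
    unfolding small_def
  proof (intro ballI)
    fix i j assume ij: "i \<in> I" "j \<in> I"
    show "bounded_by d (block i j (twist p (\<lambda>i. int n * k i) (A - mat 1)))"
    proof (cases "k i < k j")
      case True
      then have "block i j (A - mat 1) = 0" using up ij by (auto simp: upper_def block_diff block_one)
      then show ?thesis using ij p d by (simp add: block_twist bounded_by_def)
    next
      case False
      \<comment> \<open>The exponent is a natural number, so the factor has absolute value at most
        1.\<close>
      then have eq: "int n * k i - int n * k j = int (n * nat (k i - k j))"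
        by (simp add: algebra_simps)
      have "av (p powi (int n * k i - int n * k j)) = av p ^ (n * nat (k i - k j))"
        unfolding eq power_int_of_nat by (rule av_power)
      also have "\<dots> \<le> 1" using p by (intro power_le_one) auto
      finally show ?thesis
        using A ij p by (simp add: block_twist bounded_by_mat congruence_def small_def)
    qed
  qed
  then show "\<forall>n. (twist p k ^^ n) A \<in> congruence d"
    using p by (simp add: congruence_def twist_funpow twist_diff_one)
next
  assume bd: "\<forall>n. (twist p k ^^ n) A \<in> congruence d"
  show "upper k A"
    unfolding upper_def
  proof (intro ballI impI)
    fix i j assume ij: "i \<in> I" "j \<in> I" and less: "k i < k j"
    then have eq: "block i j (A - mat 1) = block i j A" by (auto simp: block_diff block_one)
    \<comment> \<open>Each twist enlarges the entries of this block by
      \<open>inverse (av p) ^ s\<close> with \<open>s \<ge> 1\<close>, so a nonzero entry eventually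
      exceeds \<open>d\<close>.\<close>
    define s where "s = nat (k j - k i)"
    have s: "s \<ge> 1" "int s = k j - k i" using less by (auto simp: s_def)
    have "av (block i j A $ a $ b) = 0" for a b
    proof (rule ccontr)
      let ?x = "av (block i j A $ a $ b)"
      assume "?x \<noteq> 0"
      then have x: "?x > 0" by (simp add: less_le)
      have "inverse (av p) > 1" using p by (simp add: one_less_inverse)
      then obtain n where n: "d / ?x < inverse (av p) ^ n" using real_arch_pow by blast
      have "small d (twist p (\<lambda>i. int n * k i) (A - mat 1))"
        using bd p by (simp add: congruence_def twist_funpow twist_diff_one)
      then have "bounded_by d (mat (p powi (int n * k i - int n * k j)) ** block i j A)"
        using ij p by (simp add: small_def block_twist flip: eq)
      then have "av (p powi (int n * k i - int n * k j)) * ?x \<le> d"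
        by (simp add: bounded_by_def av_mult)
      also have "int n * k i - int n * k j = int n * (k i - k j)" by (simp add: right_diff_distrib)
      also have "\<dots> = - int (n * s)" using s(2) by (simp add: minus_diff_eq[symmetric, of "k j"] del: minus_diff_eq)
      also have "av (p powi (- int (n * s))) = inverse (av p) ^ (n * s)"
        by (simp add: power_int_minus av_inverse av_power power_inverse del: of_nat_mult)
      finally have "inverse (av p) ^ (n * s) * ?x \<le> d" .
      moreover have "inverse (av p) ^ n \<le> inverse (av p) ^ (n * s)"
        using \<open>inverse (av p) > 1\<close> s(1) by (intro power_increasing) auto
      ultimately have "inverse (av p) ^ n * ?x \<le> d" using x
        by (meson mult_right_mono order_trans less_imp_le)
      then show False using n x by (simp add: field_simps)
    qed
    then show "block i j A = 0" by (simp add: vec_eq_iff)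
  qed
qed

text \<open>The dynamical criterion passes to inverses at once: the twists of the inverse are the
  inverses of the twists, and the congruence subgroup is closed under inversion. Multiplicativity of
  \<open>part0\<close> then gives the other two claims.\<close>

lemma upper_inverse:
  assumes A: "A \<in> congruence d" and d: "0 \<le> d" "d < 1" and up: "upper k A"
  shows "upper k (matrix_inv A)" "part0 k (matrix_inv A) ** part0 k A = mat 1"
    "part0 k A ** part0 k (matrix_inv A) = mat 1"
proof -
  obtain p :: 'f where p: "0 < av p" "av p < 1" by (rule uniformizer_exists) blast
  then have p0: "p \<noteq> 0" by auto
  have "invertible A" using A d by (rule congruence_invertible)
  show "upper k (matrix_inv A)"
    unfolding upper_iff_twist_bounded[OF congruence_inverse[OF A d] p0 p(2) d(1)]
    using up unfolding upper_iff_twist_bounded[OF A p0 p(2) d(1)]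
    by (simp add: twist_funpow p0 twist_inverse \<open>invertible A\<close> congruence_inverse d)
  then show "part0 k (matrix_inv A) ** part0 k A = mat 1"
    "part0 k A ** part0 k (matrix_inv A) = mat 1"
    using up \<open>invertible A\<close> by (simp_all add: matrix_inv_cancel part0_one flip: part0_mult)
qed

section \<open>Iwahori factors: existence, size and uniqueness\<close>

definition upper_unipotent :: "('i \<Rightarrow> int) \<Rightarrow> ('f ^ 'n ^ 'n) set" where
  "upper_unipotent k = {A. upper k A \<and> part0 k A = mat 1}"

text \<open>Intersected with the rational points of G, this becomes \<open>M\<close>, and
  \<open>upper_unipotent k\<close> becomes \<open>U\<close>.\<close>

definition centralizing :: "('i \<Rightarrow> int) \<Rightarrow> ('f ^ 'n ^ 'n) set" where
  "centralizing k = {A. upper k A \<and> upper (\<lambda>i. - k i) A}"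

text \<open>Here \<open>\<Gamma>\<close> stands for G(F). Tidying writes \<open>h = q ** x\<close>
  with \<open>q\<close> in \<open>P\<close> and \<open>x\<close> in the opposite group. Dividing
  each by its own limit \<open>m\<close> or \<open>m'\<close> leaves unipotent factors, and
  \<open>m ** m'\<close> goes to the middle.\<close>

lemma iwahori_factors_exist:
  assumes \<Gamma>: "matrix_group \<Gamma>" and e: "0 < e" "e < 1" and cpt: "compact (\<Gamma> \<inter> congruence e)"
    and p: "p \<noteq> 0" "av p < 1"
    and stable: "\<And>A. A \<in> \<Gamma> \<Longrightarrow> twist p k A \<in> \<Gamma>" "\<And>A. A \<in> \<Gamma> \<Longrightarrow> twist p (\<lambda>i. - k i) A \<in> \<Gamma>"
    and lim: "\<And>A. A \<in> \<Gamma> \<Longrightarrow> upper k A \<Longrightarrow> part0 k A \<in> \<Gamma>"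
      "\<And>A. A \<in> \<Gamma> \<Longrightarrow> upper (\<lambda>i. - k i) A \<Longrightarrow> part0 k A \<in> \<Gamma>"
  shows "\<exists>d>0. d \<le> e \<and> (\<forall>h \<in> \<Gamma> \<inter> congruence d.
     \<exists>u \<in> \<Gamma> \<inter> congruence e \<inter> upper_unipotent k. \<exists>m \<in> \<Gamma> \<inter> congruence e \<inter> centralizing k.
     \<exists>u' \<in> \<Gamma> \<inter> congruence e \<inter> upper_unipotent (\<lambda>i. - k i). h = u ** m ** u')"
proof -
  let ?k' = "\<lambda>i. - k i"
  define V where "V = \<Gamma> \<inter> congruence e"
  have e0: "0 \<le> e" using e by simp
  have cong: "matrix_group (congruence e)" using e by (intro matrix_group_congruence) auto
  have V: "matrix_group V"
    using \<Gamma> cong unfolding V_def matrix_group_def by blast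
  note [simp] = matrix_group_closed[OF V]
  have twist_inv: "twist p ?k' (twist p k A) = A" "twist p k (twist p ?k' A) = A" for A
    using p by (simp_all add: twist_twist twist_zero)
  have "openin (top_of_set V) {h \<in> V. twist p ?k' h \<in> V}"
  proof -
    \<comment> \<open>\<open>\<Gamma>\<close> is stable under the inverse twist, so only the
      congruence condition, which is open, remains.\<close>
    have "{h \<in> V. twist p ?k' h \<in> V} = V \<inter> twist p ?k' -` congruence e"
      using stable by (auto simp: V_def)
    moreover have "open (twist p ?k' -` congruence e)"
      by (intro open_vimage open_congruence e continuous_on_twist)
    ultimately show ?thesis by (auto simp: openin_open)
  qed
  then obtain N :: nat where N: "\<And>h. (\<And>n. n \<le> N \<Longrightarrow> (twist p k ^^ n) h \<in> V) \<Longrightarrow>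
      \<exists>q x. h = q ** x \<and> (\<forall>n. (twist p k ^^ n) q \<in> V) \<and> (\<forall>n. (twist p ?k' ^^ n) x \<in> V)"
    by (rule tidy_decomposition[OF cpt[folded V_def] V twist_mult[OF p(1)] twist_one[OF p(1)] twist_inv
          continuous_on_twist continuous_on_twist]) blast
  \<comment> \<open>The finitely many iterates required by tidying are controlled by shrinking the
    radius from \<open>e\<close> to some \<open>d\<close>.\<close>
  define T where "T = (\<Inter>n\<in>{..N}. twist p (\<lambda>i. int n * k i) -` congruence e)"
  have "open T" unfolding T_def by (intro open_INT ballI open_vimage open_congruence e continuous_on_twist) auto
  moreover have "mat 1 \<in> T" using p e by (simp add: T_def twist_one congruence_one)
  ultimately obtain d where d: "d > 0" "congruence d \<subseteq> T" using congruence_subset_nhd by blast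
  have stable_n: "(twist p k ^^ n) h \<in> \<Gamma>" if "h \<in> \<Gamma>" for n h
    by (induction n) (auto simp: that stable)
  show ?thesis
  proof (intro exI[of _ "min d e"] conjI ballI)
    fix h assume h: "h \<in> \<Gamma> \<inter> congruence (min d e)"
    then have "h \<in> T" using d congruence_mono[of "min d e" d] by auto
    then have "(twist p k ^^ n) h \<in> V" if "n \<le> N" for n
      using h that stable_n[of h n] p by (auto simp: T_def V_def twist_funpow)
    from N[OF this] obtain q x where qx: "h = q ** x"
      "\<And>n. (twist p k ^^ n) q \<in> V" "\<And>n. (twist p ?k' ^^ n) x \<in> V" by blast
    have q: "q \<in> V" and x: "x \<in> V" using qx(2)[of 0] qx(3)[of 0] by auto
    have qc: "q \<in> congruence e" and xc: "x \<in> congruence e" using q x by (auto simp: V_def)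
    have uq: "upper k q" using qx(2) upper_iff_twist_bounded[OF qc p e0] by (simp add: V_def)
    have ux: "upper ?k' x" using qx(3) upper_iff_twist_bounded[OF xc p e0] by (simp add: V_def)
    define m where "m = part0 k q"
    define m' where "m' = part0 k x"
    have m: "m \<in> V" "m' \<in> V"
      using q x uq ux e by (auto simp: V_def m_def m'_def lim congruence_part0)
    then have mc: "m \<in> congruence e" "m' \<in> congruence e" by (auto simp: V_def)
    have um: "upper k m" "upper ?k' m" "upper k m'" "upper ?k' m'"
      by (simp_all add: m_def m'_def upper_part0 upper_minus_part0)
    have p0m: "part0 k m = m" "part0 k m' = m'"
      using um by (simp_all add: part0_eq_self)
    note mi = upper_inverse[OF mc(1) e0 e(2) um(1)] upper_inverse[OF mc(1) e0 e(2) um(2)]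
      upper_inverse[OF mc(2) e0 e(2) um(3)] upper_inverse[OF mc(2) e0 e(2) um(4)]
    have "q ** matrix_inv m \<in> V \<inter> upper_unipotent k"
      using q m uq mi by (simp add: upper_unipotent_def upper_mult part0_mult flip: m_def) (simp add: p0m)
    moreover have "m ** m' \<in> V \<inter> centralizing k"
      using m um by (simp add: centralizing_def upper_mult)
    moreover have "matrix_inv m' ** x \<in> V \<inter> upper_unipotent ?k'"
      using x m ux mi part0_mult[of ?k' "matrix_inv m'" x]
      by (simp add: upper_unipotent_def upper_mult part0_minus flip: m'_def) (simp add: p0m)
    moreover have "h = (q ** matrix_inv m) ** (m ** m') ** (matrix_inv m' ** x)"
    proof -
      have "(q ** matrix_inv m) ** (m ** m') ** (matrix_inv m' ** x)
          = q ** (matrix_inv m ** m) ** (m' ** matrix_inv m') ** x"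
        by (simp only: matrix_mul_assoc)
      then show ?thesis using m by (simp add: qx)
    qed
    ultimately show "\<exists>u \<in> \<Gamma> \<inter> congruence e \<inter> upper_unipotent k.
       \<exists>m \<in> \<Gamma> \<inter> congruence e \<inter> centralizing k.
       \<exists>u' \<in> \<Gamma> \<inter> congruence e \<inter> upper_unipotent ?k'. h = u ** m ** u'"
      unfolding V_def by blast
  qed (use d e in auto)
qed

text \<open>
  With \<open>w\<close> the inverse of \<open>u'\<close>, the matrix \<open>u m - w = (h - 1) w\<close> is small. Off the diagonal at most one of
  \<open>u m\<close> and \<open>w\<close> has a nonzero block, and on the diagonal \<open>w\<close> agrees with \<open>1\<close>.
\<close>

lemma iwahori_factors_small:
  assumes e: "0 < e" "e < 1" and d: "0 < d" "d \<le> e"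
    and u: "u \<in> congruence e \<inter> upper_unipotent k" and m: "m \<in> congruence e \<inter> centralizing k"
    and u': "u' \<in> congruence e \<inter> upper_unipotent (\<lambda>i. - k i)"
    and h: "u ** m ** u' \<in> congruence d"
  shows "u \<in> congruence d" "m \<in> congruence d" "u' \<in> congruence d"
proof -
  let ?k' = "\<lambda>i. - k i"
  have e0: "0 \<le> e" and d0: "0 \<le> d" "d < 1" using e d by auto
  define h where "h = u ** m ** u'"
  define w where "w = matrix_inv u'"
  have inv: "invertible u'" "invertible m"
    using u' m e by (auto intro: congruence_invertible)
  have w: "w \<in> congruence e" using u' e by (simp add: w_def congruence_inverse)
  have uu': "upper ?k' u'" "part0 ?k' u' = mat 1" "upper k u" "part0 k u = mat 1" "upper k m" "upper ?k' m"
    using u u' m by (simp_all add: upper_unipotent_def centralizing_def)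
  have uw: "upper ?k' w" "part0 k w = mat 1"
    using upper_inverse[of u' e ?k'] u' uu'(1,2) e by (simp_all add: w_def part0_minus)
  have um: "upper k (u ** m)" "part0 k (u ** m) = m"
    using uu' by (simp_all add: upper_mult part0_mult part0_eq_self)
  have hw: "u ** m = h ** w"
    using inv by (simp add: h_def w_def matrix_inv_cancel flip: matrix_mul_assoc)
  have diff: "small d (u ** m - w)"
  proof -
    have "small (d * e) ((h - mat 1) ** (w - mat 1))"
      using h w e0 d0 by (intro small_mult) (auto simp: h_def congruence_def)
    then have "small d ((h - mat 1) ** (w - mat 1))"
      using e d0 by (elim small_mono) (simp add: mult_left_le)
    then have "small d ((h - mat 1) ** (w - mat 1) + (h - mat 1))"
      using h by (intro small_add) (auto simp: h_def congruence_def)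
    also have "(h - mat 1) ** (w - mat 1) + (h - mat 1) = u ** m - w"
      unfolding hw by (simp add: matrix_diff_ldistrib matrix_diff_rdistrib)
    finally show ?thesis .
  qed
  have "small d (m - mat 1)"
  proof -
    \<comment> \<open>On blocks of equal weight \<open>u ** m\<close> agrees with \<open>m\<close>,
      and \<open>w\<close> with 1.\<close>
    have "m - mat 1 = part0 k (u ** m - w)"
    proof (rule block_eqI)
      fix i j assume ij: "i \<in> I" "j \<in> I"
      have "block i j m = block i j (part0 k (u ** m))" "block i j (mat 1) = block i j (part0 k w)"
        by (simp_all add: um uw)
      then show "block i j (m - mat 1) = block i j (part0 k (u ** m - w))"
        using ij by (simp add: block_diff block_part0)
    qed
    then show ?thesis using diff d0 by (simp add: small_part0)
  qed
  then show mc: "m \<in> congruence d" by (simp add: congruence_def)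
  \<comment> \<open>For \<open>k i < k j\<close> the block of \<open>u ** m\<close> vanishes, so
    that of \<open>w\<close> is minus the small difference. On the remaining blocks \<open>w\<close>
    agrees with 1.\<close>
  have wd: "small d (w - mat 1)"
    unfolding small_def
  proof (intro ballI)
    fix i j assume ij: "i \<in> I" "j \<in> I"
    show "bounded_by d (block i j (w - mat 1))"
    proof (cases "k i" "k j" rule: linorder_cases)
      case less
      then have "block i j (w - mat 1) = 0 - block i j (u ** m - w)"
        using um(1) ij by (auto simp: upper_def block_diff block_one)
      moreover have "bounded_by d (0 - block i j (u ** m - w))"
        using diff ij d0 by (intro bounded_by_diff) (auto simp: small_def bounded_by_def)
      ultimately show ?thesis by simp
    next
      case equal
      have "block i j (part0 k w) = block i j (mat 1)" by (simp add: uw)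
      then show ?thesis using equal ij d0 by (simp add: block_part0 block_diff bounded_by_def)
    next
      case greater
      then have "block i j (w - mat 1) = 0"
        using uw(1) ij by (auto simp: upper_def block_diff block_one)
      then show ?thesis using d0 by (simp add: bounded_by_def)
    qed
  qed
  then have wc: "w \<in> congruence d" by (simp add: congruence_def)
  have "matrix_inv w = u'" using inv by (intro matrix_inv_unique) (simp add: w_def matrix_inv_cancel)
  then show "u' \<in> congruence d" using congruence_inverse[OF wc d0] by simp
  have "small d ((u ** m - w) + (w - mat 1))" using diff wd by (rule small_add)
  then have "u ** m \<in> congruence d" by (simp add: congruence_def)
  moreover have "u = u ** m ** matrix_inv m"
    using inv by (simp add: matrix_inv_cancel flip: matrix_mul_assoc)
  ultimately show "u \<in> congruence d"
    using congruence_mult[of "u ** m" d "matrix_inv m"] congruence_inverse[OF mc d0] d0 by simp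
qed

text \<open>The matrix \<open>y = matrix_inv v ** u ** m\<close> equals
  \<open>l ** (v' ** matrix_inv u')\<close>, so it is \<open>upper\<close> for both \<open>k\<close>
  and its negative and coincides with its \<open>part0\<close>. The first expression has
  \<open>part0\<close> equal to \<open>m\<close>, the second to \<open>l\<close>.\<close>

lemma iwahori_factors_unique:
  assumes e: "0 < e" "e < 1"
    and u: "u \<in> congruence e \<inter> upper_unipotent k" "v \<in> congruence e \<inter> upper_unipotent k"
    and m: "m \<in> congruence e \<inter> centralizing k" "l \<in> congruence e \<inter> centralizing k"
    and u': "u' \<in> congruence e \<inter> upper_unipotent (\<lambda>i. - k i)" "v' \<in> congruence e \<inter> upper_unipotent (\<lambda>i. - k i)"
    and eq: "u ** m ** u' = v ** l ** v'"
  shows "u = v" "m = l" "u' = v'"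
proof -
  let ?k' = "\<lambda>i. - k i"
  have e0: "0 \<le> e" using e by simp
  have inv: "invertible u" "invertible v" "invertible m" "invertible l" "invertible u'" "invertible v'"
    using u m u' e by (auto intro: congruence_invertible)
  have up: "upper k u" "upper k v" "upper k m" "upper k l" "upper ?k' m" "upper ?k' l" "upper ?k' u'" "upper ?k' v'"
    and p0: "part0 k u = mat 1" "part0 k v = mat 1" "part0 k u' = mat 1" "part0 k v' = mat 1"
    using u m u' by (simp_all add: upper_unipotent_def centralizing_def part0_minus)
  have vi: "upper k (matrix_inv v)" "part0 k (matrix_inv v) = mat 1"
    using upper_inverse[of v e k] u(2) e up p0 by simp_all
  have ui: "upper ?k' (matrix_inv u')" "part0 k (matrix_inv u') = mat 1"
    using upper_inverse[of u' e ?k'] u'(1) e up p0 by (simp_all add: part0_minus)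
  define y where "y = matrix_inv v ** u ** m"
  have "matrix_inv v ** (u ** m ** u') ** matrix_inv u' = matrix_inv v ** (v ** l ** v') ** matrix_inv u'"
    by (simp add: eq)
  moreover have "matrix_inv v ** (u ** m ** u') ** matrix_inv u' = y ** (u' ** matrix_inv u')"
    unfolding y_def by (simp only: matrix_mul_assoc)
  moreover have "matrix_inv v ** (v ** l ** v') ** matrix_inv u' = (matrix_inv v ** v) ** (l ** (v' ** matrix_inv u'))"
    by (simp only: matrix_mul_assoc)
  ultimately have y: "y = l ** (v' ** matrix_inv u')"
    using inv by (simp add: matrix_inv_cancel)
  have "upper k y" unfolding y_def using up vi by (simp add: upper_mult)
  moreover have "upper ?k' y" unfolding y using up ui by (simp add: upper_mult)
  ultimately have "part0 k y = y" by (rule part0_eq_self)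
  moreover have "part0 k y = m"
    unfolding y_def using up vi p0 by (simp add: upper_mult part0_mult part0_eq_self)
  moreover have "part0 k y = l"
    unfolding y using up ui p0 part0_mult[of ?k'] by (simp add: upper_mult part0_minus part0_eq_self)
  ultimately have yml: "y = m" "y = l" by auto
  then show "m = l" by simp
  have "matrix_inv v ** u = matrix_inv v ** u ** m ** matrix_inv m"
    using inv by (simp add: matrix_inv_cancel flip: matrix_mul_assoc)
  also have "\<dots> = mat 1" using yml inv by (simp add: y_def matrix_inv_cancel)
  finally have "v ** (matrix_inv v ** u) = v" by simp
  then show "u = v" using inv by (simp add: matrix_mul_assoc matrix_inv_cancel)
  have "v' ** matrix_inv u' = matrix_inv l ** l ** (v' ** matrix_inv u')"
    using inv by (simp add: matrix_inv_cancel)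
  also have "\<dots> = matrix_inv l ** (l ** (v' ** matrix_inv u'))" by (simp only: matrix_mul_assoc)
  also have "\<dots> = mat 1" using yml y inv by (simp add: matrix_inv_cancel)
  finally have "v' ** matrix_inv u' ** u' = u'" by simp
  then show "u' = v'" using inv by (simp add: matrix_inv_cancel flip: matrix_mul_assoc)
qed

text \<open>The constant \<open>c\<close> is uniform in \<open>\<K>\<close>, which may be infinite,
  and works for every smaller radius \<open>d\<close>. This leaves room to shrink \<open>K\<close>
  into a prescribed neighbourhood.\<close>

lemma iwahori_bij_exists:
  assumes \<Gamma>: "matrix_group \<Gamma>" and e: "0 < e" "e < 1" and cpt: "compact (\<Gamma> \<inter> congruence e)"
    and p: "p \<noteq> 0" "av p < 1"
    and stable: "\<And>k A. k \<in> \<K> \<Longrightarrow> A \<in> \<Gamma> \<Longrightarrow> twist p k A \<in> \<Gamma>"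
      "\<And>k A. k \<in> \<K> \<Longrightarrow> A \<in> \<Gamma> \<Longrightarrow> twist p (\<lambda>i. - k i) A \<in> \<Gamma>"
    and lim: "\<And>k A. k \<in> \<K> \<Longrightarrow> A \<in> \<Gamma> \<Longrightarrow> upper k A \<Longrightarrow> part0 k A \<in> \<Gamma>"
      "\<And>k A. k \<in> \<K> \<Longrightarrow> A \<in> \<Gamma> \<Longrightarrow> upper (\<lambda>i. - k i) A \<Longrightarrow> part0 k A \<in> \<Gamma>"
  obtains c where "0 < c" "c \<le> e"
    "\<And>d k. 0 < d \<Longrightarrow> d \<le> c \<Longrightarrow> k \<in> \<K> \<Longrightarrow> bij_betw (\<lambda>(u, m, u'). u ** m ** u')
      ((\<Gamma> \<inter> congruence d \<inter> upper_unipotent k) \<times> (\<Gamma> \<inter> congruence d \<inter> centralizing k) \<times>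
       (\<Gamma> \<inter> congruence d \<inter> upper_unipotent (\<lambda>i. - k i))) (\<Gamma> \<inter> congruence d)"
proof -
  define sgn where "sgn k = {(i, j) \<in> I \<times> I. k i < k j}" for k :: "'i \<Rightarrow> int"
  \<comment> \<open>The factors are only asked to have radius \<open>e\<close>, which makes
    \<open>good\<close> monotone in \<open>c\<close>; \<open>iwahori_factors_small\<close> later
    brings them down to the radius of the product.\<close>
  define good where "good k c \<longleftrightarrow> (\<forall>h \<in> \<Gamma> \<inter> congruence c. \<exists>u \<in> \<Gamma> \<inter> congruence e \<inter> upper_unipotent k.
       \<exists>m \<in> \<Gamma> \<inter> congruence e \<inter> centralizing k.
       \<exists>u' \<in> \<Gamma> \<inter> congruence e \<inter> upper_unipotent (\<lambda>i. - k i). h = u ** m ** u')" for k c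
  have good_mono: "good k c \<Longrightarrow> c' \<le> c \<Longrightarrow> good k c'" for k c c'
    using congruence_mono[of c' c] unfolding good_def by blast
  have good_sgn: "good k c \<longleftrightarrow> good l c" if "sgn k = sgn l" for k l c
    using sign_pattern[OF that[unfolded sgn_def]]
    by (simp add: good_def upper_unipotent_def centralizing_def part0_minus)
  have ex: "\<exists>c>0. c \<le> e \<and> good k c" if k: "k \<in> \<K>" for k
    unfolding good_def by (rule iwahori_factors_exist[OF \<Gamma> e cpt p stable[OF k] lim[OF k]])
  have fin: "finite (sgn ` \<K>)"
    by (rule finite_subset[of _ "Pow (I \<times> I)"]) (use finite_I in \<open>auto simp: sgn_def\<close>)
  have "\<exists>c>0. c \<le> e \<and> (\<forall>k\<in>\<K>. sgn k \<in> R \<longrightarrow> good k c)" if "R \<subseteq> sgn ` \<K>" for R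
    using finite_subset[OF that fin] that
  proof (induction R rule: finite_induct)
    case empty
    then show ?case using e by auto
  next
    case (insert r R)
    then obtain k where k: "k \<in> \<K>" "r = sgn k" by blast
    obtain c where c: "c > 0" "c \<le> e" "\<forall>k\<in>\<K>. sgn k \<in> R \<longrightarrow> good k c" using insert by auto
    obtain c' where c': "c' > 0" "c' \<le> e" "good k c'" using ex[OF k(1)] by blast
    \<comment> \<open>A weight function with the new pattern \<open>r\<close> inherits the radius
      \<open>c'\<close> of the representative \<open>k\<close>.\<close>
    have "good l (min c c')" if "l \<in> \<K>" "sgn l \<in> insert r R" for l
      using that c c' k good_sgn[of l k c'] good_mono[of l _ "min c c'"] by auto
    then show ?case using c c' by (intro exI[of _ "min c c'"]) auto
  qed
  from this[of "sgn ` \<K>"] obtain c where c: "c > 0" "c \<le> e" "\<And>k. k \<in> \<K> \<Longrightarrow> good k c" by auto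
  show ?thesis
  proof (rule that[OF c(1,2)])
    fix d k assume d: "0 < d" "d \<le> c" and k: "k \<in> \<K>"
    have de: "d \<le> e" "d < 1" using d c e by auto
    let ?K = "\<Gamma> \<inter> congruence d"
    have group: "matrix_group ?K"
      using \<Gamma> matrix_group_congruence[of d] d de unfolding matrix_group_def by auto
    show "bij_betw (\<lambda>(u, m, u'). u ** m ** u')
      ((?K \<inter> upper_unipotent k) \<times> (?K \<inter> centralizing k) \<times> (?K \<inter> upper_unipotent (\<lambda>i. - k i))) ?K"
      unfolding bij_betw_def
    proof
      show "inj_on (\<lambda>(u, m, u'). u ** m ** u')
        ((?K \<inter> upper_unipotent k) \<times> (?K \<inter> centralizing k) \<times> (?K \<inter> upper_unipotent (\<lambda>i. - k i)))"
        (is "inj_on ?f ?D")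
      proof (rule inj_onI)
        fix x y assume xy: "x \<in> ?D" "y \<in> ?D" "?f x = ?f y"
        obtain u m u' v l v' where eq: "x = (u, m, u')" "y = (v, l, v')" by (cases x, cases y) auto
        show "x = y"
          using iwahori_factors_unique[OF d(1) de(2), of u k v m l u' v'] xy unfolding eq by simp
      qed
      show "(\<lambda>(u, m, u'). u ** m ** u') `
        ((?K \<inter> upper_unipotent k) \<times> (?K \<inter> centralizing k) \<times> (?K \<inter> upper_unipotent (\<lambda>i. - k i))) = ?K"
        (is "?f ` ?D = _")
      proof
        show "?f ` ?D \<subseteq> ?K" using matrix_group_closed(2)[OF group] by auto
        show "?K \<subseteq> ?f ` ?D"
        proof
          fix h assume h: "h \<in> ?K"
          then have "h \<in> \<Gamma> \<inter> congruence c" using congruence_mono[OF d(2)] by blast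
          then obtain u m u' where *: "u \<in> \<Gamma> \<inter> congruence e \<inter> upper_unipotent k"
            "m \<in> \<Gamma> \<inter> congruence e \<inter> centralizing k"
            "u' \<in> \<Gamma> \<inter> congruence e \<inter> upper_unipotent (\<lambda>i. - k i)" "h = u ** m ** u'"
            using c(3)[OF k] unfolding good_def by blast
          then have "(u, m, u') \<in> ?D"
            using iwahori_factors_small[OF e d(1) de(1), of u k m u'] h by blast
          then show "h \<in> ?f ` ?D" by (rule image_eqI[rotated]) (simp add: *(4))
        qed
      qed
    qed
  qed
qed

end

section \<open>Weights of a split torus\<close>

text \<open>A common frame for GL_1 and its powers. The domain is a set because the points of a
  power are functions restricted to an initial segment.\<close>

locale character_setting =
  fixes D :: "'d set" and mul :: "'d \<Rightarrow> 'd \<Rightarrow> 'd"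
  assumes mul_closed: "x \<in> D \<Longrightarrow> y \<in> D \<Longrightarrow> mul x y \<in> D" and nonempty: "D \<noteq> {}"
begin

text \<open>Extensionality makes distinct characters differ at a point of \<open>D\<close>.\<close>

definition characters :: "('d \<Rightarrow> 'k::field) set" where
  "characters = {\<eta> \<in> extensional D. (\<forall>x\<in>D. \<eta> x \<noteq> 0) \<and> (\<forall>x\<in>D. \<forall>y\<in>D. \<eta> (mul x y) = \<eta> x * \<eta> y)}"

text \<open>Dedekind's argument: translate a relation by \<open>y\<close> and subtract
  \<open>\<psi> y\<close> times the original. This removes \<open>\<psi>\<close> and multiplies the
  coefficient of \<open>\<eta>\<close> by \<open>\<eta> y - \<psi> y\<close>, which is nonzero for a
  suitable \<open>y\<close>.\<close>

lemma characters_independent: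
  assumes "finite T" "T \<subseteq> characters" "\<And>x. x \<in> D \<Longrightarrow> (\<Sum>\<eta>\<in>T. c \<eta> * \<eta> x) = 0"
  shows "\<eta> \<in> T \<Longrightarrow> c \<eta> = 0"
  using assms
proof (induction T arbitrary: c \<eta> rule: finite_induct)
  case (insert \<psi> T)
  have \<psi>: "\<psi> \<in> characters" and T: "T \<subseteq> characters" using insert.prems by auto
  have zero: "c \<eta> = 0" if "\<eta> \<in> T" for \<eta>
  proof -
    have "\<eta> \<noteq> \<psi>" "\<eta> \<in> characters" using that insert.hyps T by auto
    then obtain y where y: "y \<in> D" "\<eta> y \<noteq> \<psi> y"
      using \<psi> extensionalityI[of \<eta> D \<psi>] unfolding characters_def by blast
    have "(\<Sum>\<eta>\<in>T. (c \<eta> * (\<eta> y - \<psi> y)) * \<eta> x) = 0" if x: "x \<in> D" for x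
    proof -
      have "(\<Sum>\<eta>\<in>insert \<psi> T. c \<eta> * \<eta> (mul x y)) = 0" "(\<Sum>\<eta>\<in>insert \<psi> T. c \<eta> * \<eta> x) = 0"
        using insert.prems(3) x y mul_closed by blast+
      then have "(\<Sum>\<eta>\<in>insert \<psi> T. c \<eta> * \<eta> (mul x y)) - \<psi> y * (\<Sum>\<eta>\<in>insert \<psi> T. c \<eta> * \<eta> x) = 0"
        by simp
      also have "(\<Sum>\<eta>\<in>insert \<psi> T. c \<eta> * \<eta> (mul x y)) - \<psi> y * (\<Sum>\<eta>\<in>insert \<psi> T. c \<eta> * \<eta> x)
          = (\<Sum>\<eta>\<in>insert \<psi> T. (c \<eta> * (\<eta> y - \<psi> y)) * \<eta> x)"
        unfolding sum_distrib_left sum_subtractf[symmetric]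
      proof (rule sum.cong[OF refl])
        fix \<eta> assume "\<eta> \<in> insert \<psi> T"
        then have "\<eta> (mul x y) = \<eta> x * \<eta> y" using insert.prems(2) x y by (auto simp: characters_def)
        then show "c \<eta> * \<eta> (mul x y) - \<psi> y * (c \<eta> * \<eta> x) = c \<eta> * (\<eta> y - \<psi> y) * \<eta> x"
          by (simp add: algebra_simps)
      qed
      finally show ?thesis using insert.hyps by simp
    qed
    then have "c \<eta> * (\<eta> y - \<psi> y) = 0" using insert.IH[OF that T, of "\<lambda>\<eta>. c \<eta> * (\<eta> y - \<psi> y)"] by blast
    then show ?thesis using y by simp
  qed
  obtain x where x: "x \<in> D" using nonempty by blast
  have "c \<psi> * \<psi> x = 0" using insert.prems(3)[OF x] insert.hyps zero by simp
  then have "c \<psi> = 0" using \<psi> x by (auto simp: characters_def)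
  then show ?case using insert.prems zero by auto
qed simp

lemma characters_coeff_unique:
  assumes "finite T" "T \<subseteq> characters" "\<And>x. x \<in> D \<Longrightarrow> (\<Sum>\<eta>\<in>T. c \<eta> * \<eta> x) = (\<Sum>\<eta>\<in>T. d \<eta> * \<eta> x)" "\<eta> \<in> T"
  shows "c \<eta> = d \<eta>"
  using characters_independent[OF assms(1,2), of "\<lambda>\<eta>. c \<eta> - d \<eta>" \<eta>] assms(3,4)
  by (simp add: left_diff_distrib sum_subtractf)

text \<open>The span of \<open>M\<close> over F, with equality of functions tested on
  \<open>D\<close> only.\<close>

definition combinations :: "('d \<Rightarrow> 'f::field alg_closure) set \<Rightarrow> ('d \<Rightarrow> 'f alg_closure) set" where
  "combinations M = {f. \<exists>T c. finite T \<and> T \<subseteq> M \<and> (\<forall>\<eta>. c \<eta> \<in> base_field) \<and> (\<forall>x\<in>D. f x = (\<Sum>\<eta>\<in>T. c \<eta> * \<eta> x))}"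

lemma base_field_closed:
  "0 \<in> base_field" "1 \<in> base_field" "a \<in> base_field \<Longrightarrow> b \<in> base_field \<Longrightarrow> a + b \<in> base_field"
  "a \<in> base_field \<Longrightarrow> b \<in> base_field \<Longrightarrow> a * b \<in> base_field" "a \<in> base_field \<Longrightarrow> inverse a \<in> base_field"
proof -
  show "0 \<in> base_field" "1 \<in> base_field"
    using rangeI[of to_ac 0] rangeI[of to_ac 1] by simp_all
  show "a + b \<in> base_field" "a * b \<in> base_field" if "a \<in> base_field" "b \<in> base_field"
    using that by (auto simp flip: to_ac_add to_ac_mult)
  show "inverse a \<in> base_field" if "a \<in> base_field"
    using that by (auto simp flip: to_ac_inverse)
qed

lemma combinations_extend:
  assumes "finite T'" "T \<subseteq> T'"
  shows "(\<Sum>\<eta>\<in>T'. (if \<eta> \<in> T then c \<eta> else 0) * \<eta> x) = (\<Sum>\<eta>\<in>T. c \<eta> * (\<eta> x :: 'k::field))"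
  using assms by (intro sum.mono_neutral_cong_right) auto

lemma combinations_cong:
  assumes "f \<in> combinations M" "\<And>x. x \<in> D \<Longrightarrow> f x = g x"
  shows "g \<in> combinations M"
proof -
  obtain T c where "finite T" "T \<subseteq> M" "\<forall>\<eta>. c \<eta> \<in> base_field" "\<forall>x\<in>D. f x = (\<Sum>\<eta>\<in>T. c \<eta> * \<eta> x)"
    using assms(1) unfolding combinations_def by blast
  then show ?thesis
    unfolding combinations_def using assms(2) by (intro CollectI exI[of _ T] exI[of _ c]) simp
qed

lemma combinations_add:
  assumes "f \<in> combinations M" "g \<in> combinations M"
  shows "(\<lambda>x. f x + g x) \<in> combinations M"
proof -
  obtain T c where f: "finite T" "T \<subseteq> M" "\<And>\<eta>. c \<eta> \<in> base_field" "\<And>x. x \<in> D \<Longrightarrow> f x = (\<Sum>\<eta>\<in>T. c \<eta> * \<eta> x)"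
    using assms(1) unfolding combinations_def by blast
  obtain T' c' where g: "finite T'" "T' \<subseteq> M" "\<And>\<eta>. c' \<eta> \<in> base_field" "\<And>x. x \<in> D \<Longrightarrow> g x = (\<Sum>\<eta>\<in>T'. c' \<eta> * \<eta> x)"
    using assms(2) unfolding combinations_def by blast
  let ?c = "\<lambda>\<eta>. (if \<eta> \<in> T then c \<eta> else 0) + (if \<eta> \<in> T' then c' \<eta> else 0)"
  have "f x + g x = (\<Sum>\<eta>\<in>T \<union> T'. ?c \<eta> * \<eta> x)" if "x \<in> D" for x
    using combinations_extend[of "T \<union> T'" T c x] combinations_extend[of "T \<union> T'" T' c' x] f(1,4) g(1,4) that
    by (simp add: distrib_right sum.distrib)
  moreover have "\<forall>\<eta>. ?c \<eta> \<in> base_field" by (simp add: f(3) g(3) base_field_closed)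
  ultimately show ?thesis
    unfolding combinations_def using f(1,2) g(1,2) by (intro CollectI exI[of _ "T \<union> T'"] exI[of _ ?c]) auto
qed

lemma combinations_zero: "(\<lambda>x. 0) \<in> combinations M"
  unfolding combinations_def using base_field_closed
  by (intro CollectI exI[of _ "{}"] exI[of _ "\<lambda>_. 0"]) auto

lemma combinations_sum: "(\<And>i. i \<in> J \<Longrightarrow> f i \<in> combinations M) \<Longrightarrow> (\<lambda>x. \<Sum>i\<in>J. f i x) \<in> combinations M"
  by (induction J rule: infinite_finite_induct) (auto intro: combinations_zero combinations_add)

lemma combinations_single:
  assumes "a \<in> base_field" "\<eta> \<in> M"
  shows "(\<lambda>x. a * \<eta> x) \<in> combinations M"
  unfolding combinations_def using assms
  by (intro CollectI exI[of _ "{\<eta>}"] exI[of _ "\<lambda>_. a"]) auto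

lemma combinations_mult:
  assumes M: "\<And>\<eta> \<psi>. \<eta> \<in> M \<Longrightarrow> \<psi> \<in> M \<Longrightarrow> restrict (\<lambda>x. \<eta> x * \<psi> x) D \<in> M"
    and fg: "f \<in> combinations M" "g \<in> combinations M"
  shows "(\<lambda>x. f x * g x) \<in> combinations M"
proof -
  obtain T c where f: "finite T" "T \<subseteq> M" "\<And>\<eta>. c \<eta> \<in> base_field" "\<And>x. x \<in> D \<Longrightarrow> f x = (\<Sum>\<eta>\<in>T. c \<eta> * \<eta> x)"
    using fg(1) unfolding combinations_def by blast
  obtain T' c' where g: "finite T'" "T' \<subseteq> M" "\<And>\<eta>. c' \<eta> \<in> base_field" "\<And>x. x \<in> D \<Longrightarrow> g x = (\<Sum>\<eta>\<in>T'. c' \<eta> * \<eta> x)"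
    using fg(2) unfolding combinations_def by blast
  have "(\<lambda>x. \<Sum>\<eta>\<in>T. \<Sum>\<psi>\<in>T'. (c \<eta> * c' \<psi>) * restrict (\<lambda>x. \<eta> x * \<psi> x) D x) \<in> combinations M"
    using f g M by (intro combinations_sum combinations_single base_field_closed) blast+
  then show ?thesis
    by (rule combinations_cong) (auto simp: f g sum_product intro!: sum.cong)
qed

lemma gen_algebra_combinations:
  assumes M: "restrict (\<lambda>_. 1) D \<in> M" "\<And>\<eta> \<psi>. \<eta> \<in> M \<Longrightarrow> \<psi> \<in> M \<Longrightarrow> restrict (\<lambda>x. \<eta> x * \<psi> x) D \<in> M"
    and B: "\<And>b. b \<in> B \<Longrightarrow> restrict b D \<in> M"
    and f: "f \<in> gen_algebra base_field B"
  shows "f \<in> combinations M"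
  using f
proof induction
  case (const c)
  show ?case
    by (rule combinations_cong[OF combinations_single[OF const M(1)]]) simp
next
  case (gen f)
  show ?case
    by (rule combinations_cong[OF combinations_single[OF base_field_closed(2) B[OF gen]]]) simp
qed (auto intro: combinations_add combinations_mult M)

text \<open>Otherwise moving \<open>\<theta>\<close> to the other side gives a relation with
  coefficient -1 among distinct characters. This will identify a regular character of GL_1 as a
  power of \<open>t\<close>.\<close>

lemma character_mem_combinations:
  assumes M: "M \<subseteq> characters" and \<theta>: "\<theta> \<in> characters" "\<theta> \<in> combinations M"
  shows "\<theta> \<in> M"
proof (rule ccontr)
  assume "\<theta> \<notin> M"
  obtain T c where T: "finite T" "T \<subseteq> M" "\<And>x. x \<in> D \<Longrightarrow> \<theta> x = (\<Sum>\<eta>\<in>T. c \<eta> * \<eta> x)"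
    using \<theta>(2) unfolding combinations_def by blast
  have nT: "\<theta> \<notin> T" using T \<open>\<theta> \<notin> M\<close> by blast
  have zero: "(\<Sum>\<eta>\<in>insert \<theta> T. (if \<eta> = \<theta> then - 1 else c \<eta>) * \<eta> x) = 0" if "x \<in> D" for x
  proof -
    have "(\<Sum>\<eta>\<in>T. (if \<eta> = \<theta> then - 1 else c \<eta>) * \<eta> x) = (\<Sum>\<eta>\<in>T. c \<eta> * \<eta> x)"
      using nT by (intro sum.cong) auto
    then show ?thesis using nT T that by simp
  qed
  have "insert \<theta> T \<subseteq> characters" using T M \<theta> by blast
  then have "(if \<theta> = \<theta> then - 1 else c \<theta>) = 0"
    using characters_independent[of "insert \<theta> T" "\<lambda>\<eta>. if \<eta> = \<theta> then - 1 else c \<eta>" \<theta>] T(1) zero by blast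
  then show False by simp
qed

end

section \<open>Characters of GL_1 and of its powers\<close>

interpretation Gm: character_setting "UNIV - {0} :: 'k::field set" "(*)"
proof
  show "UNIV - {0} \<noteq> ({} :: 'k set)" using one_neq_zero by blast
qed auto

definition Gm_characters :: "('k::field \<Rightarrow> 'k) set" where
  "Gm_characters = range (\<lambda>n::int. restrict (\<lambda>t. t powi n) (UNIV - {0}))"

lemma Gm_characters_subset: "Gm_characters \<subseteq> Gm.characters"
  by (auto simp: Gm_characters_def Gm.characters_def power_int_mult_distrib split: if_splits)

text \<open>Regular functions on GL_1 are Laurent polynomials over F.\<close>

lemma regular_Gm_combinations:
  assumes "regular_on base_field {\<lambda>t. t, \<lambda>t. inverse t} (UNIV - {0}) f"
  shows "f \<in> Gm.combinations Gm_characters"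
proof -
  have pw: "restrict (\<lambda>t. t powi n) (UNIV - {0}) \<in> Gm_characters" for n :: int
    by (simp add: Gm_characters_def)
  obtain h where h: "h \<in> gen_algebra base_field {\<lambda>t. t, \<lambda>t. inverse t}" "\<forall>x\<in>UNIV - {0}. f x = h x"
    using assms unfolding regular_on_def by blast
  have "h \<in> Gm.combinations Gm_characters"
  proof (rule Gm.gen_algebra_combinations[OF _ _ _ h(1)])
    show "restrict (\<lambda>_. 1) (UNIV - {0}) \<in> Gm_characters"
      using pw[of 0] by simp
    show "restrict b (UNIV - {0}) \<in> Gm_characters" if "b \<in> {\<lambda>t. t, \<lambda>t. inverse t}" for b
      using that pw[of 1] pw[of "-1"] by (auto simp: power_int_minus)
    fix \<eta> \<psi> :: "'a alg_closure \<Rightarrow> 'a alg_closure" assume "\<eta> \<in> Gm_characters" "\<psi> \<in> Gm_characters"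
    then obtain m n :: int where "\<eta> = restrict (\<lambda>t. t powi m) (UNIV - {0})"
      "\<psi> = restrict (\<lambda>t. t powi n) (UNIV - {0})" by (auto simp: Gm_characters_def)
    then have "restrict (\<lambda>x. \<eta> x * \<psi> x) (UNIV - {0}) = restrict (\<lambda>t. t powi (m + n)) (UNIV - {0})"
      by (auto simp: fun_eq_iff power_int_add)
    then show "restrict (\<lambda>x. \<eta> x * \<psi> x) (UNIV - {0}) \<in> Gm_characters" using pw by simp
  qed
  then show ?thesis by (rule Gm.combinations_cong) (use h in auto)
qed

definition Gm_power_mul :: "nat \<Rightarrow> (nat \<Rightarrow> 'k::field) \<Rightarrow> (nat \<Rightarrow> 'k) \<Rightarrow> nat \<Rightarrow> 'k" where
  "Gm_power_mul r x y = (\<lambda>i\<in>{..<r}. x i * y i)"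

lemma Gm_power_one: "(\<lambda>i\<in>{..<r}. 1) \<in> Gm_power r"
  by (auto simp: Gm_power_def)

interpretation Gm_power: character_setting "Gm_power r :: (nat \<Rightarrow> 'k::field) set" "Gm_power_mul r" for r
proof
  show "Gm_power_mul r x y \<in> Gm_power r" if "x \<in> Gm_power r" "y \<in> Gm_power r" for x y :: "nat \<Rightarrow> 'k"
    using that by (auto simp: Gm_power_def Gm_power_mul_def PiE_iff)
qed (use Gm_power_one in auto)

text \<open>The generating coordinates and their inverses are characters, and characters are closed
  under products. Integer exponents appear only after composition with a cocharacter.\<close>

lemma regular_Gm_power_combinations:
  assumes "regular_on base_field (Gm_power_coords r) (Gm_power r) f"
  shows "f \<in> Gm_power.combinations r (Gm_power.characters r)"
proof -
  obtain h where h: "h \<in> gen_algebra base_field (Gm_power_coords r)" "\<forall>x\<in>Gm_power r. f x = h x"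
    using assms unfolding regular_on_def by blast
  have cl: "restrict f (Gm_power r) \<in> Gm_power.characters r"
    if "\<And>x. x \<in> Gm_power r \<Longrightarrow> f x \<noteq> 0"
      "\<And>x y. x \<in> Gm_power r \<Longrightarrow> y \<in> Gm_power r \<Longrightarrow> f (Gm_power_mul r x y) = f x * f y" for f :: "_ \<Rightarrow> 'a alg_closure"
    using that by (auto simp: Gm_power.characters_def Gm_power.mul_closed)
  have "h \<in> Gm_power.combinations r (Gm_power.characters r)"
  proof (rule Gm_power.gen_algebra_combinations[OF _ _ _ h(1)])
    fix b :: "(nat \<Rightarrow> 'a alg_closure) \<Rightarrow> 'a alg_closure" assume "b \<in> Gm_power_coords r"
    then show "restrict b (Gm_power r) \<in> Gm_power.characters r"
      by (intro cl) (auto simp: Gm_power_coords_def Gm_power_def PiE_iff Gm_power_mul_def)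
  next
    fix \<eta> \<psi> :: "(nat \<Rightarrow> 'a alg_closure) \<Rightarrow> 'a alg_closure"
    assume "\<eta> \<in> Gm_power.characters r" "\<psi> \<in> Gm_power.characters r"
    then show "restrict (\<lambda>x. \<eta> x * \<psi> x) (Gm_power r) \<in> Gm_power.characters r"
      by (intro cl) (auto simp: Gm_power.characters_def)
  qed (intro cl, auto)
  then show ?thesis by (rule Gm_power.combinations_cong) (use h in auto)
qed

section \<open>Scalar extension of matrices and the weights of S\<close>

lemma map_matrix_to_ac_mult: "map_matrix to_ac (A ** B) = map_matrix to_ac A ** map_matrix to_ac B"
  by (simp add: vec_eq_iff matrix_matrix_mult_def to_ac_sum)

lemma map_matrix_to_ac_mat: "map_matrix to_ac (mat c) = mat (to_ac c)"
  by (simp add: vec_eq_iff mat_def)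

lemma map_matrix_to_ac_sum: "map_matrix to_ac (\<Sum>i\<in>J. f i) = (\<Sum>i\<in>J. map_matrix to_ac (f i))"
  by (simp add: vec_eq_iff to_ac_sum)

lemma map_matrix_to_ac_eq_iff: "map_matrix to_ac A = map_matrix to_ac B \<longleftrightarrow> A = B"
  by (simp add: vec_eq_iff)

lemma split_torus_weights:
  fixes S :: "('f::field alg_closure ^ 'n ^ 'n) set"
  assumes "split_torus S"
  obtains I :: "((nat \<Rightarrow> 'f alg_closure) \<Rightarrow> 'f alg_closure) set" and E :: "_ \<Rightarrow> 'f ^ 'n ^ 'n"
  where "idempotents I E"
    "\<And>\<mu>. cocharacter S \<mu> \<Longrightarrow>
      \<exists>k. \<forall>t. t \<noteq> 0 \<longrightarrow> \<mu> t = (\<Sum>i\<in>I. mat (t powi k i) ** map_matrix to_ac (E i))"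
proof -
  obtain r and \<phi> :: "(nat \<Rightarrow> 'f alg_closure) \<Rightarrow> 'f alg_closure ^ 'n ^ 'n" and \<psi>
    where reg: "\<And>i j. regular_on base_field (Gm_power_coords r) (Gm_power r) (\<lambda>x. \<phi> x $ i $ j)"
    and hom: "\<And>x y. x \<in> Gm_power r \<Longrightarrow> y \<in> Gm_power r \<Longrightarrow> \<phi> (Gm_power_mul r x y) = \<phi> x ** \<phi> y"
    and \<phi>S: "\<And>x. x \<in> Gm_power r \<Longrightarrow> \<phi> x \<in> S"
    and \<psi>: "\<And>s. s \<in> S \<Longrightarrow> \<psi> s \<in> Gm_power r \<and> \<phi> (\<psi> s) = s"
    and S: "linear_algebraic_group S"
    using assms unfolding split_torus_def Gm_power_mul_def by blast
  define D where "D = (Gm_power r :: (nat \<Rightarrow> 'f alg_closure) set)"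
  define Q where "Q i j T c \<longleftrightarrow> finite T \<and> T \<subseteq> Gm_power.characters r \<and> (\<forall>\<eta>. c \<eta> \<in> base_field) \<and>
      (\<forall>x\<in>D. \<phi> x $ i $ j = (\<Sum>\<eta>\<in>T. c \<eta> * \<eta> x))" for i j T c
  have "\<forall>i j. \<exists>T c. Q i j T c"
    using regular_Gm_power_combinations[OF reg] unfolding Q_def Gm_power.combinations_def D_def by blast
  then obtain T where "\<forall>i j. \<exists>c. Q i j (T i j) c" by metis
  then obtain c where Q: "\<And>i j. Q i j (T i j) (c i j)" by metis
  have T: "\<And>i j. finite (T i j)" "\<And>i j. T i j \<subseteq> Gm_power.characters r"
    and c: "\<And>i j \<eta>. c i j \<eta> \<in> base_field"
    and \<phi>: "\<And>i j x. x \<in> D \<Longrightarrow> \<phi> x $ i $ j = (\<Sum>\<eta>\<in>T i j. c i j \<eta> * \<eta> x)"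
    using Q unfolding Q_def by blast+
  define I where "I = (\<Union>i. \<Union>j. T i j)"
  have I: "finite I" "I \<subseteq> Gm_power.characters r" unfolding I_def using T(1) UN_least[OF UN_least[OF T(2)]] by simp_all
  \<comment> \<open>\<open>E \<eta>\<close> collects the coefficients of \<open>\<eta>\<close> in
    the entries of \<open>\<phi>\<close>. They lie in F and are pulled back there; an entry in which
    \<open>\<eta>\<close> is not listed gets 0.\<close>
  define E :: "_ \<Rightarrow> 'f ^ 'n ^ 'n" where "E \<eta> = (\<chi> i j. if \<eta> \<in> T i j then of_ac (c i j \<eta>) else 0)" for \<eta>
  define E' where "E' \<eta> = map_matrix to_ac (E \<eta>)" for \<eta>
  have E': "E' \<eta> $ i $ j = (if \<eta> \<in> T i j then c i j \<eta> else 0)" for \<eta> i j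
    using c by (simp add: E'_def E_def to_ac_of_ac)
  have \<phi>E: "\<phi> x = (\<Sum>\<eta>\<in>I. mat (\<eta> x) ** E' \<eta>)" if "x \<in> D" for x
  proof -
    have "\<phi> x $ i $ j = (\<Sum>\<eta>\<in>I. E' \<eta> $ i $ j * \<eta> x)" for i j
      unfolding E' \<phi>[OF that] using I T
      by (intro sum.mono_neutral_cong_left) (auto simp: I_def)
    then show ?thesis by (simp add: vec_eq_iff mult.commute)
  qed
  have unique: "A = B" if "\<And>x. x \<in> D \<Longrightarrow> (\<Sum>\<eta>\<in>I. mat (\<eta> x) ** F \<eta>) = (\<Sum>\<eta>\<in>I. mat (\<eta> x) ** F' \<eta>)"
    and "\<eta> \<in> I" "F \<eta> = A" "F' \<eta> = B" for F F' :: "_ \<Rightarrow> 'f alg_closure ^ 'n ^ 'n" and \<eta> A B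
  proof -
    have "F \<eta> $ i $ j = F' \<eta> $ i $ j" for i j
    proof (rule Gm_power.characters_coeff_unique[OF I _ that(2)])
      fix x :: "nat \<Rightarrow> 'f alg_closure" assume "x \<in> Gm_power r"
      then have "(\<Sum>\<eta>\<in>I. mat (\<eta> x) ** F \<eta>) $ i $ j = (\<Sum>\<eta>\<in>I. mat (\<eta> x) ** F' \<eta>) $ i $ j"
        using that(1) by (simp add: D_def)
      then show "(\<Sum>\<eta>\<in>I. F \<eta> $ i $ j * \<eta> x) = (\<Sum>\<eta>\<in>I. F' \<eta> $ i $ j * \<eta> x)"
        by (simp add: mult.commute)
    qed
    then show ?thesis using that by (simp add: vec_eq_iff)
  qed
  have mul: "\<eta> (Gm_power_mul r x y) = \<eta> x * \<eta> y" if "\<eta> \<in> I" "x \<in> D" "y \<in> D" for \<eta> x y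
    using that I by (auto simp: D_def Gm_power.characters_def)
  \<comment> \<open>Compare coefficients of \<open>\<eta> x\<close> in \<open>\<phi>\<close> of a
    product and the product of the values, with \<open>y\<close> fixed. Comparing in
    \<open>y\<close> next gives orthogonality.\<close>
  have E\<phi>: "E' \<eta> ** \<phi> y = mat (\<eta> y) ** E' \<eta>" if "\<eta> \<in> I" "y \<in> D" for \<eta> y
  proof (rule sym, rule unique[OF _ that(1) refl refl])
    fix x assume x: "x \<in> D"
    have "(\<Sum>\<eta>\<in>I. mat (\<eta> x) ** (mat (\<eta> y) ** E' \<eta>)) = (\<Sum>\<eta>\<in>I. mat (\<eta> (Gm_power_mul r x y)) ** E' \<eta>)"
      using x that by (intro sum.cong) (auto simp: mul)
    also have "\<dots> = \<phi> (Gm_power_mul r x y)"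
      using x that Gm_power.mul_closed[of x r y] by (simp add: \<phi>E D_def)
    also have "\<dots> = (\<Sum>\<eta>\<in>I. mat (\<eta> x) ** E' \<eta>) ** \<phi> y"
      using x that by (simp add: hom D_def flip: \<phi>E)
    also have "\<dots> = (\<Sum>\<eta>\<in>I. mat (\<eta> x) ** (E' \<eta> ** \<phi> y))"
      by (simp add: matrix_sum_rdistrib matrix_mul_assoc)
    finally show "(\<Sum>\<eta>\<in>I. mat (\<eta> x) ** (mat (\<eta> y) ** E' \<eta>)) = (\<Sum>\<eta>\<in>I. mat (\<eta> x) ** (E' \<eta> ** \<phi> y))" .
  qed
  have orth: "E' \<eta> ** E' \<psi> = (if \<eta> = \<psi> then E' \<eta> else 0)" if "\<eta> \<in> I" "\<psi> \<in> I" for \<eta> \<psi>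
  proof (rule unique[OF _ that(2) refl refl])
    fix y assume y: "y \<in> D"
    have "(\<Sum>\<psi>\<in>I. mat (\<psi> y) ** (E' \<eta> ** E' \<psi>)) = E' \<eta> ** (\<Sum>\<psi>\<in>I. mat (\<psi> y) ** E' \<psi>)"
      by (simp add: matrix_sum_ldistrib) (metis matrix_mul_mat_left)
    also have "\<dots> = E' \<eta> ** \<phi> y" by (simp add: \<phi>E[OF y])
    also have "\<dots> = mat (\<eta> y) ** E' \<eta>" by (rule E\<phi>[OF that(1) y])
    also have "\<dots> = (\<Sum>\<psi>\<in>I. if \<eta> = \<psi> then mat (\<psi> y) ** E' \<psi> else 0)"
      using that I by simp
    also have "\<dots> = (\<Sum>\<psi>\<in>I. mat (\<psi> y) ** (if \<eta> = \<psi> then E' \<eta> else 0))"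
      by (intro sum.cong) auto
    finally show "(\<Sum>\<psi>\<in>I. mat (\<psi> y) ** (E' \<eta> ** E' \<psi>)) = (\<Sum>\<psi>\<in>I. mat (\<psi> y) ** (if \<eta> = \<psi> then E' \<eta> else 0))" .
  qed
  have sum: "(\<Sum>\<eta>\<in>I. E' \<eta>) = mat 1"
  proof -
    \<comment> \<open>At the neutral element all characters are 1, so the sum is
      \<open>\<phi> e\<close>, an invertible idempotent.\<close>
    define e :: "nat \<Rightarrow> 'f alg_closure" where "e = (\<lambda>i\<in>{..<r}. 1)"
    have e: "e \<in> D" "Gm_power_mul r e e = e"
      using Gm_power_one by (auto simp: e_def D_def Gm_power_mul_def)
    have "E' \<eta> = mat (\<eta> e) ** E' \<eta>" if "\<eta> \<in> I" for \<eta>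
    proof -
      have "\<eta> e * \<eta> e = \<eta> e" using mul[OF that e(1) e(1)] e(2) by simp
      moreover have "\<eta> e \<noteq> 0" using that I e by (auto simp: D_def Gm_power.characters_def)
      ultimately have "\<eta> e = 1" by simp
      then show ?thesis by simp
    qed
    then have "(\<Sum>\<eta>\<in>I. E' \<eta>) = (\<Sum>\<eta>\<in>I. mat (\<eta> e) ** E' \<eta>)" by (intro sum.cong refl)
    then have "(\<Sum>\<eta>\<in>I. E' \<eta>) = \<phi> e" by (simp only: \<phi>E[OF e(1)])
    moreover have "\<phi> e ** \<phi> e = \<phi> e" using hom[of e e] e by (simp add: D_def)
    moreover have "invertible (\<phi> e)"
      using \<phi>S[of e] e S by (auto simp: D_def linear_algebraic_group_def matrix_group_def GL_def)
    ultimately show ?thesis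
      by (metis matrix_inv_cancel(2) matrix_mul_assoc matrix_mul_lid)
  qed
  have "idempotents I E"
  proof
    show "finite I" by (rule I)
    show "E i ** E j = (if i = j then E i else 0)" if "i \<in> I" "j \<in> I" for i j
    proof -
      have "map_matrix to_ac (E i ** E j) = map_matrix to_ac (if i = j then E i else 0)"
        using orth[OF that] by (simp add: map_matrix_to_ac_mult E'_def) (simp add: vec_eq_iff)
      then show ?thesis by (simp only: map_matrix_to_ac_eq_iff)
    qed
    show "(\<Sum>i\<in>I. E i) = mat 1"
      using sum unfolding E'_def
      by (simp add: map_matrix_to_ac_eq_iff flip: map_matrix_to_ac_sum map_matrix_to_ac_mat[of 1, simplified])
  qed
  moreover have "\<exists>k. \<forall>t. t \<noteq> 0 \<longrightarrow> \<mu> t = (\<Sum>i\<in>I. mat (t powi k i) ** map_matrix to_ac (E i))"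
    if \<mu>: "cocharacter S \<mu>" for \<mu> :: "'f alg_closure \<Rightarrow> 'f alg_closure ^ 'n ^ 'n"
  proof -
    define y where "y t = \<psi> (\<mu> t)" for t
    have \<mu>S: "\<mu> t \<in> S" if "t \<noteq> 0" for t using \<mu> that by (auto simp: cocharacter_def)
    have y: "y t \<in> D" "\<mu> t = \<phi> (y t)" if "t \<noteq> 0" for t
      using \<psi>[OF \<mu>S[OF that]] by (auto simp: y_def D_def)
    have weight: "\<exists>n::int. \<forall>t. t \<noteq> 0 \<longrightarrow> \<eta> (y t) = t powi n" if \<eta>: "\<eta> \<in> I" "E' \<eta> \<noteq> 0" for \<eta>
    proof -
      \<comment> \<open>At a nonzero entry \<open>b\<close>, the identity \<open>E\<mu>\<close>
        below can be solved for \<open>\<eta> (y t)\<close>. It becomes an F-combination of entries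
        of \<open>\<mu> t\<close>, hence a Laurent polynomial, and being multiplicative it is a
        single power of \<open>t\<close>.\<close>
      obtain i j where ij: "E' \<eta> $ i $ j \<noteq> 0" using \<eta>(2) by (auto simp: vec_eq_iff)
      define b where "b = E' \<eta> $ i $ j"
      have base: "E' \<eta> $ i $ j \<in> base_field" for i j by (simp add: E'_def)
      have E\<mu>: "E' \<eta> ** \<mu> t = mat (\<eta> (y t)) ** E' \<eta>" if "t \<noteq> 0" for t
        using E\<phi>[OF \<eta>(1) y(1)[OF that]] y(2)[OF that] by simp
      define \<theta> where "\<theta> = restrict (\<lambda>t. \<eta> (y t)) (UNIV - {0})"
      have "\<eta> (y t) = (\<Sum>l\<in>UNIV. (inverse b * E' \<eta> $ i $ l) * \<mu> t $ l $ j)" if "t \<noteq> 0" for t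
      proof -
        have "\<eta> (y t) * b = (E' \<eta> ** \<mu> t) $ i $ j" using E\<mu>[OF that] by (simp add: b_def)
        also have "\<dots> = (\<Sum>l\<in>UNIV. E' \<eta> $ i $ l * \<mu> t $ l $ j)" by (simp add: matrix_matrix_mult_def)
        finally have "\<eta> (y t) = inverse b * (\<Sum>l\<in>UNIV. E' \<eta> $ i $ l * \<mu> t $ l $ j)"
          using ij by (simp add: b_def field_simps)
        then show ?thesis by (simp add: sum_distrib_left mult.assoc)
      qed
      moreover have "(\<lambda>t. \<Sum>l\<in>UNIV. (inverse b * E' \<eta> $ i $ l) * \<mu> t $ l $ j) \<in> Gm.combinations Gm_characters"
      proof (intro Gm.combinations_sum)
        fix l
        have "regular_on base_field {\<lambda>t. t, \<lambda>t. inverse t} (UNIV - {0}) (\<lambda>t. \<mu> t $ l $ j)"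
          using \<mu> by (simp add: cocharacter_def)
        then obtain h where h: "h \<in> gen_algebra base_field {\<lambda>t. t, \<lambda>t. inverse t}"
          "\<forall>t\<in>UNIV - {0}. \<mu> t $ l $ j = h t" unfolding regular_on_def by blast
        let ?a = "inverse b * E' \<eta> $ i $ l"
        have "?a \<in> base_field"
          using base by (intro Gm.base_field_closed) (simp_all add: b_def)
        then have "(\<lambda>t. ?a * h t) \<in> gen_algebra base_field {\<lambda>t. t, \<lambda>t. inverse t}"
          by (intro gen_algebra.mult gen_algebra.const h)
        then have "regular_on base_field {\<lambda>t. t, \<lambda>t. inverse t} (UNIV - {0}) (\<lambda>t. ?a * \<mu> t $ l $ j)"
          unfolding regular_on_def using h(2) by (intro bexI[of _ "\<lambda>t. ?a * h t"]) auto
        then show "(\<lambda>t. ?a * \<mu> t $ l $ j) \<in> Gm.combinations Gm_characters"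
          by (rule regular_Gm_combinations)
      qed
      ultimately have "\<theta> \<in> Gm.combinations Gm_characters"
        by (elim Gm.combinations_cong) (auto simp: \<theta>_def)
      moreover have "\<theta> \<in> Gm.characters"
      proof -
        have "\<eta> (y t) \<noteq> 0" if "t \<noteq> 0" for t
          using y(1)[OF that] \<eta>(1) I by (auto simp: D_def Gm_power.characters_def)
        moreover have "\<eta> (y (s * t)) = \<eta> (y s) * \<eta> (y t)" if "s \<noteq> 0" "t \<noteq> 0" for s t
        proof -
          have "mat (\<eta> (y (s * t))) ** E' \<eta> = E' \<eta> ** \<mu> s ** \<mu> t"
            using E\<mu>[of "s * t"] that \<mu> by (simp add: cocharacter_def matrix_mul_assoc)
          also have "\<dots> = mat (\<eta> (y s)) ** (E' \<eta> ** \<mu> t)"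
            using E\<mu>[OF that(1)] by (simp add: matrix_mul_assoc)
          also have "\<dots> = mat (\<eta> (y s) * \<eta> (y t)) ** E' \<eta>"
            using E\<mu>[OF that(2)] by simp
          finally have "(mat (\<eta> (y (s * t))) ** E' \<eta>) $ i $ j = (mat (\<eta> (y s) * \<eta> (y t)) ** E' \<eta>) $ i $ j"
            by simp
          then show ?thesis using ij by simp
        qed
        ultimately show ?thesis by (auto simp: \<theta>_def Gm.characters_def)
      qed
      ultimately have "\<theta> \<in> Gm_characters"
        using Gm.character_mem_combinations[OF Gm_characters_subset] by blast
      then obtain n :: int where n: "\<theta> = restrict (\<lambda>t. t powi n) (UNIV - {0})" by (auto simp: Gm_characters_def)
      have "\<eta> (y t) = t powi n" if "t \<noteq> 0" for t
        using fun_cong[OF n, of t] that by (simp add: \<theta>_def)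
      then show ?thesis by blast
    qed
    \<comment> \<open>If all listed coefficients of \<open>\<eta>\<close> vanish, then
      \<open>E' \<eta> = 0\<close>; the arbitrary weight chosen in that case multiplies a zero
      summand.\<close>
    define k where "k \<eta> = (SOME n::int. \<forall>t. t \<noteq> 0 \<longrightarrow> \<eta> (y t) = t powi n)" for \<eta>
    have k: "\<eta> (y t) = t powi k \<eta>" if "\<eta> \<in> I" "E' \<eta> \<noteq> 0" "t \<noteq> 0" for \<eta> t
      using someI_ex[OF weight[OF that(1,2)]] that(3) unfolding k_def by blast
    have "\<mu> t = (\<Sum>\<eta>\<in>I. mat (t powi k \<eta>) ** E' \<eta>)" if "t \<noteq> 0" for t
    proof -
      have "mat (\<eta> (y t)) ** E' \<eta> = mat (t powi k \<eta>) ** E' \<eta>" if "\<eta> \<in> I" for \<eta>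
        using k[OF that _ \<open>t \<noteq> 0\<close>] by (cases "E' \<eta> = 0") auto
      then show ?thesis using y[OF that] by (simp add: \<phi>E)
    qed
    then show ?thesis unfolding E'_def by blast
  qed
  ultimately show ?thesis by (rule that)
qed

section \<open>Limits of one-parameter conjugations\<close>

definition poly_fun :: "('k::field \<Rightarrow> 'k) \<Rightarrow> bool" where
  "poly_fun f \<longleftrightarrow> (\<exists>P. \<forall>t. f t = poly P t)"

lemma poly_fun_const: "poly_fun (\<lambda>_. c)"
  and poly_fun_id: "poly_fun (\<lambda>t. t)"
  unfolding poly_fun_def by (rule exI[of _ "[:c:]"], simp, rule exI[of _ "[:0, 1:]"], simp)

lemma poly_fun_add: "poly_fun f \<Longrightarrow> poly_fun g \<Longrightarrow> poly_fun (\<lambda>t. f t + g t)"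
  unfolding poly_fun_def by (metis poly_add)

lemma poly_fun_mult: "poly_fun f \<Longrightarrow> poly_fun g \<Longrightarrow> poly_fun (\<lambda>t. f t * g t)"
  unfolding poly_fun_def by (metis poly_mult)

lemma poly_fun_power: "poly_fun f \<Longrightarrow> poly_fun (\<lambda>t. f t ^ n)"
  by (induction n) (auto intro: poly_fun_mult poly_fun_const)

lemma poly_fun_sum: "(\<And>i. i \<in> J \<Longrightarrow> poly_fun (f i)) \<Longrightarrow> poly_fun (\<lambda>t. \<Sum>i\<in>J. f i t)"
  by (induction J rule: infinite_finite_induct) (auto intro: poly_fun_add poly_fun_const)

lemma poly_fun_prod: "(\<And>i. i \<in> J \<Longrightarrow> poly_fun (f i)) \<Longrightarrow> poly_fun (\<lambda>t. \<Prod>i\<in>J. f i t)"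
  by (induction J rule: infinite_finite_induct) (auto intro: poly_fun_mult poly_fun_const)

lemma poly_fun_If: "(b \<Longrightarrow> poly_fun f) \<Longrightarrow> (\<not> b \<Longrightarrow> poly_fun g) \<Longrightarrow> poly_fun (\<lambda>t. if b then f t else g t)"
  by (cases b) simp_all

lemma regular_on_line_iff: "regular_on UNIV {\<lambda>t. t} UNIV f \<longleftrightarrow> poly_fun f"
proof
  assume "regular_on UNIV {\<lambda>t. t} UNIV f"
  then obtain h where h: "h \<in> gen_algebra UNIV {\<lambda>t. t}" "f = h" unfolding regular_on_def by auto
  from h(1) have "poly_fun h"
    by induction (auto intro: poly_fun_const poly_fun_id poly_fun_add poly_fun_mult)
  then show "poly_fun f" using h by simp
next
  assume "poly_fun f"
  then obtain P where P: "f = poly P" unfolding poly_fun_def by auto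
  have "poly P \<in> gen_algebra UNIV {\<lambda>t. t}"
  proof (induction P)
    case 0
    then show ?case using gen_algebra.const[of 0 UNIV "{\<lambda>t. t}"] by simp
  next
    case (pCons a P)
    have "(\<lambda>t. a + t * poly P t) \<in> gen_algebra UNIV {\<lambda>t. t}"
      by (intro gen_algebra.add gen_algebra.mult gen_algebra.const gen_algebra.gen pCons) auto
    then show ?case by (simp add: fun_eq_iff[symmetric] cong: if_cong)
  qed
  then show "regular_on UNIV {\<lambda>t. t} UNIV f" unfolding regular_on_def P by blast
qed

text \<open>The difference polynomial has infinitely many roots. This is the algebraic form of
  uniqueness of limits.\<close>

lemma poly_fun_eq_at_0:
  fixes f g :: "'k::field \<Rightarrow> 'k"
  assumes inf: "infinite (UNIV :: 'k set)" and f: "poly_fun f" "poly_fun g" and eq: "\<And>t. t \<noteq> 0 \<Longrightarrow> f t = g t"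
  shows "f 0 = g 0"
proof -
  obtain P Q where PQ: "\<And>t. f t = poly P t" "\<And>t. g t = poly Q t" using f unfolding poly_fun_def by blast
  have "P - Q = 0"
  proof (rule ccontr)
    assume "P - Q \<noteq> 0"
    then have "finite {t. poly (P - Q) t = 0}" by (rule poly_roots_finite)
    moreover have "UNIV - {0} \<subseteq> {t. poly (P - Q) t = 0}" using eq PQ by auto
    ultimately show False using inf by (meson finite_Diff2 finite_subset finite.emptyI finite_insert)
  qed
  then show ?thesis using PQ by simp
qed

lemma poly_fun_matrix_mult:
  fixes A B :: "'k::field \<Rightarrow> 'k ^ 'n ^ 'n"
  assumes "\<And>i j. poly_fun (\<lambda>t. A t $ i $ j)" "\<And>i j. poly_fun (\<lambda>t. B t $ i $ j)"
  shows "poly_fun (\<lambda>t. (A t ** B t) $ i $ j)"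
  unfolding matrix_matrix_mult_def by (simp add: poly_fun_sum poly_fun_mult assms)

text \<open>Constancy of the determinant keeps the limit invertible and makes the coordinate
  \<open>inverse (det A)\<close> constant along \<open>q\<close>. Every equation of \<open>G\<close>
  then becomes a polynomial in \<open>t\<close> that vanishes off 0, hence also at 0.\<close>

lemma zariski_closed_limit:
  fixes G :: "('k::field ^ 'n ^ 'n) set" and q :: "'k \<Rightarrow> 'k ^ 'n ^ 'n"
  assumes inf: "infinite (UNIV :: 'k set)" and G: "zariski_closed G"
    and q: "\<And>i j. poly_fun (\<lambda>t. q t $ i $ j)" "\<And>t. t \<noteq> 0 \<Longrightarrow> q t \<in> G"
    and det: "\<And>t. t \<noteq> 0 \<Longrightarrow> det (q t) = d"
  shows "q 0 \<in> G"
proof -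
  obtain Es where Es: "Es \<subseteq> gen_algebra UNIV GL_coords" "G = {A \<in> GL. \<forall>f\<in>Es. f A = 0}"
    using G unfolding zariski_closed_def by blast
  have "poly_fun (\<lambda>t. det (q t))"
    unfolding det_def by (intro poly_fun_sum poly_fun_mult poly_fun_const poly_fun_prod q)
  then have "det (q 0) = d"
    by (rule poly_fun_eq_at_0[OF inf _ poly_fun_const]) (rule det)
  then have detq: "det (q t) = d" for t using det by (cases "t = 0") auto
  have "q 1 \<in> G" using q(2) by simp
  then have "det (q 1) \<noteq> 0" using Es(2) by (auto simp: GL_def invertible_det_nz)
  then have "q 0 \<in> GL" by (simp add: GL_def invertible_det_nz detq)
  moreover have "f (q 0) = 0" if f: "f \<in> Es" for f
  proof -
    have "f \<in> gen_algebra UNIV GL_coords" using f Es by blast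
    then have "poly_fun (\<lambda>t. f (q t))"
    proof induction
      case (gen f)
      then show ?case
        by (auto simp: GL_coords_def detq intro: q(1) poly_fun_const)
    qed (auto intro: poly_fun_const poly_fun_add poly_fun_mult)
    then show ?thesis
      by (rule poly_fun_eq_at_0[OF inf _ poly_fun_const]) (use q(2) f Es in blast)
  qed
  ultimately show ?thesis using Es by blast
qed

section \<open>Extending conjugation by a cocharacter to 0\<close>

context idempotents
begin

text \<open>For \<open>upper\<close> matrices this is the conjugate, written with natural exponents
  so that it makes sense at 0. There \<open>0 ^ 0 = 1\<close> leaves exactly the blocks of
  \<open>part0\<close>.\<close>

definition cochar_path :: "('i \<Rightarrow> int) \<Rightarrow> 'k ^ 'n ^ 'n \<Rightarrow> 'k \<Rightarrow> 'k ^ 'n ^ 'n" where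
  "cochar_path k g t = (\<Sum>i\<in>I. \<Sum>j\<in>I. mat (if k j \<le> k i then t ^ nat (k i - k j) else 0) ** block i j g)"

lemma block_cochar_path:
  "i \<in> I \<Longrightarrow> j \<in> I \<Longrightarrow>
    block i j (cochar_path k g t) = mat (if k j \<le> k i then t ^ nat (k i - k j) else 0) ** block i j g"
  unfolding cochar_path_def by (rule block_double_sum)

lemma cochar_path_eq_twist:
  assumes "upper k g" "t \<noteq> 0"
  shows "cochar_path k g t = twist t k g"
proof (rule block_eqI)
  fix i j assume "i \<in> I" "j \<in> I"
  then show "block i j (cochar_path k g t) = block i j (twist t k g)"
    using assms by (auto simp: block_cochar_path block_twist power_int_def upper_def)
qed

lemma cochar_path_0: "cochar_path k g 0 = part0 k g"
proof (rule block_eqI)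
  fix i j assume "i \<in> I" "j \<in> I"
  then show "block i j (cochar_path k g 0) = block i j (part0 k g)"
    by (auto simp: block_cochar_path block_part0 power_0_left)
qed

lemma poly_fun_cochar_path: "poly_fun (\<lambda>t. cochar_path k g t $ a $ b)"
  unfolding cochar_path_def sum_component mat_mult_nth
  by (intro poly_fun_sum poly_fun_mult poly_fun_If poly_fun_const poly_fun_power poly_fun_id)

lemma det_twist: "t \<noteq> 0 \<Longrightarrow> det (twist t k g) = det g"
proof -
  assume t: "t \<noteq> 0"
  have "det (diag k t) * det (diag (\<lambda>i. - k i) t) = 1"
    using t by (simp add: diag_mult_diag_minus flip: det_mul)
  then show ?thesis by (simp add: twist_def det_mul mult.commute mult.left_commute)
qed

context
  fixes G :: "('k ^ 'n ^ 'n) set" and \<mu> :: "'k \<Rightarrow> 'k ^ 'n ^ 'n" and k :: "'i \<Rightarrow> int"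
  assumes inf: "infinite (UNIV :: 'k set)" and group: "matrix_group G" and closed: "zariski_closed G"
    and \<mu>: "\<And>t. t \<noteq> 0 \<Longrightarrow> \<mu> t = diag k t" "\<And>t. t \<noteq> 0 \<Longrightarrow> \<mu> t \<in> G"
begin

lemma conj_eq_twist: "t \<noteq> 0 \<Longrightarrow> \<mu> t ** g ** matrix_inv (\<mu> t) = twist t k g"
  by (simp add: \<mu>(1) matrix_inv_diag twist_def)

lemma twist_closed: "t \<noteq> 0 \<Longrightarrow> g \<in> G \<Longrightarrow> twist t k g \<in> G"
  unfolding conj_eq_twist[symmetric] by (intro matrix_group_closed[OF group] \<mu>)

lemma cochar_path_closed:
  assumes g: "g \<in> G" "upper k g"
  shows "cochar_path k g t \<in> G"
proof -
  have nz: "cochar_path k g t \<in> G" if "t \<noteq> 0" for t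
    using that g by (simp add: cochar_path_eq_twist twist_closed)
  moreover have "cochar_path k g 0 \<in> G"
    by (rule zariski_closed_limit[OF inf closed poly_fun_cochar_path nz])
      (use g in \<open>auto simp: cochar_path_eq_twist det_twist\<close>)
  ultimately show ?thesis by (cases "t = 0") auto
qed

lemma part0_closed: "g \<in> G \<Longrightarrow> upper k g \<Longrightarrow> part0 k g \<in> G"
  using cochar_path_closed[of g 0] by (simp add: cochar_path_0)

lemma has_limit_iff:
  assumes g: "g \<in> G"
  shows "has_limit_at_0 G \<mu> g l \<longleftrightarrow> upper k g \<and> l = part0 k g"
proof
  assume "upper k g \<and> l = part0 k g"
  then show "has_limit_at_0 G \<mu> g l"
    unfolding has_limit_at_0_def regular_on_line_iff using g
    by (intro exI[of _ "cochar_path k g"])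
      (auto simp: poly_fun_cochar_path cochar_path_closed conj_eq_twist cochar_path_eq_twist cochar_path_0)
next
  assume "has_limit_at_0 G \<mu> g l"
  then obtain q :: "'k \<Rightarrow> 'k ^ 'n ^ 'n" where q: "\<And>i j. poly_fun (\<lambda>t. q t $ i $ j)" "\<And>t. t \<noteq> 0 \<Longrightarrow> q t = twist t k g" "q 0 = l"
    unfolding has_limit_at_0_def regular_on_line_iff using conj_eq_twist by auto
  have pb: "poly_fun (\<lambda>t. block i j (q t) $ a $ b)" for i j a b
    unfolding block_def by (intro poly_fun_matrix_mult q poly_fun_const)
  have up: "block i j g = 0" if ij: "i \<in> I" "j \<in> I" "k i < k j" for i j
  proof -
    \<comment> \<open>Multiplying by \<open>t ^ n\<close> cancels the pole: off 0 the product with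
      the block of \<open>q t\<close> is constantly the block of \<open>g\<close>, while at 0 it
      vanishes.\<close>
    define n where "n = nat (k j - k i)"
    have n: "n > 0" "k i - k j = - int n" using ij by (auto simp: n_def)
    have "0 ^ n * block i j (q 0) $ a $ b = block i j g $ a $ b" for a b
    proof (rule poly_fun_eq_at_0[OF inf poly_fun_mult[OF poly_fun_power[OF poly_fun_id] pb] poly_fun_const])
      fix t :: 'k assume "t \<noteq> 0"
      then show "t ^ n * block i j (q t) $ a $ b = block i j g $ a $ b"
        using ij n by (simp add: q block_twist power_int_minus)
    qed
    moreover have "(0 :: 'k) ^ n = 0" using n by simp
    ultimately have "block i j g $ a $ b = 0" for a b by (metis mult_zero_left)
    then show ?thesis by (simp add: vec_eq_iff)
  qed
  then have "upper k g" by (simp add: upper_def)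
  moreover have "q 0 $ a $ b = cochar_path k g 0 $ a $ b" for a b
    by (rule poly_fun_eq_at_0[OF inf q(1) poly_fun_cochar_path])
      (simp add: q \<open>upper k g\<close> cochar_path_eq_twist)
  ultimately show "upper k g \<and> l = part0 k g"
    using q(3) by (simp add: vec_eq_iff cochar_path_0)
qed

lemma P_group_eq: "P_group G \<mu> = {g \<in> G. upper k g}"
  and U_group_eq: "U_group G \<mu> = {g \<in> G. upper k g \<and> part0 k g = mat 1}"
  by (auto simp: P_group_def U_group_def has_limit_iff)

end

end

section \<open>Rational points\<close>

lemma det_map_matrix_to_ac: "det (map_matrix to_ac A) = to_ac (det A)"
proof -
  have "to_ac (of_int (sign p) * c) = of_int (sign p) * to_ac c" for p and c :: 'a
    by simp
  then show ?thesis by (simp add: det_def to_ac_sum to_ac_prod)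
qed

lemma invertible_map_matrix_to_ac: "invertible (map_matrix to_ac A) \<longleftrightarrow> invertible A"
  for A :: "'f::field ^ 'n ^ 'n"
  by (simp add: invertible_det_nz det_map_matrix_to_ac)

lemma to_ac_power_int: "to_ac (x powi n) = to_ac x powi n"
  by (simp add: power_int_def)

lemma matrix_group_rational_points:
  assumes "matrix_group G"
  shows "matrix_group (rational_points G)"
  unfolding matrix_group_def
proof (intro conjI ballI)
  note G = matrix_group_closed[OF assms]
  have inv: "invertible A" if "A \<in> rational_points G" for A
    using that assms invertible_map_matrix_to_ac[of A]
    by (auto simp: rational_points_def matrix_group_def GL_def)
  then show "rational_points G \<subseteq> GL" by (auto simp: GL_def)
  show "mat 1 \<in> rational_points G"
    using G(1) by (simp add: rational_points_def map_matrix_to_ac_mat)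
  show "A ** B \<in> rational_points G" if "A \<in> rational_points G" "B \<in> rational_points G" for A B
    using that G(2) by (simp add: rational_points_def map_matrix_to_ac_mult)
  show "matrix_inv A \<in> rational_points G" if A: "A \<in> rational_points G" for A
  proof -
    have "map_matrix to_ac A ** map_matrix to_ac (matrix_inv A) = mat 1"
      using inv[OF A] by (simp add: matrix_inv_cancel map_matrix_to_ac_mat flip: map_matrix_to_ac_mult)
    then have "map_matrix to_ac (matrix_inv A) = matrix_inv (map_matrix to_ac A)"
      by (metis matrix_inv_unique)
    then show ?thesis using A G(3) by (simp add: rational_points_def)
  qed
qed

text \<open>The topology lives on F and not on its closure, so a regular function over F is first
  replaced by its F-valued restriction to matrices over F.\<close>

lemma regular_base_continuous:
  fixes h :: "'f::nonarch_local_field alg_closure ^ 'n ^ 'n \<Rightarrow> 'f alg_closure"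
  assumes "h \<in> gen_algebra base_field GL_coords"
  shows "\<exists>h'. continuous_on GL h' \<and> (\<forall>A. h (map_matrix to_ac A) = to_ac (h' A))"
  using assms
proof induction
  case (const c)
  then obtain c' where "c = to_ac c'" by blast
  then show ?case by (intro exI[of _ "\<lambda>_. c'"]) auto
next
  case (gen f)
  then consider i j where "f = (\<lambda>A. A $ i $ j)" | "f = (\<lambda>A. inverse (det A))"
    unfolding GL_coords_def by blast
  then show ?case
  proof cases
    case 1
    then show ?thesis by (intro exI[of _ "\<lambda>A. A $ i $ j"]) (auto intro!: continuous_intros)
  next
    case 2
    have "continuous_on GL (\<lambda>A :: 'f ^ 'n ^ 'n. inverse (det A))"
      by (intro continuous_intros) (auto simp: GL_def invertible_det_nz)
    then show ?thesis using 2 by (intro exI[of _ "\<lambda>A. inverse (det A)"]) (simp add: det_map_matrix_to_ac)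
  qed
next
  case (add f g)
  then obtain f' g' where "continuous_on GL f'" "\<forall>A. f (map_matrix to_ac A) = to_ac (f' A)"
    "continuous_on GL g'" "\<forall>A. g (map_matrix to_ac A) = to_ac (g' A)" by blast
  then show ?case by (intro exI[of _ "\<lambda>A. f' A + g' A"]) (auto intro!: continuous_intros)
next
  case (mult f g)
  then obtain f' g' where "continuous_on GL f'" "\<forall>A. f (map_matrix to_ac A) = to_ac (f' A)"
    "continuous_on GL g'" "\<forall>A. g (map_matrix to_ac A) = to_ac (g' A)" by blast
  then show ?case by (intro exI[of _ "\<lambda>A. f' A * g' A"]) (auto intro!: continuous_intros)
qed

text \<open>The set \<open>C\<close> keeps the determinant away from the singular locus, where the
  equations are not continuous. Being closed itself, it makes relatively closed conditions closed in
  the matrix space.\<close>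

lemma rational_points_closed_in_GL:
  fixes G :: "('f::nonarch_local_field alg_closure ^ 'n ^ 'n) set"
  assumes G: "zariski_closed G" "defined_over_base G" and C: "closed C" "C \<subseteq> GL"
  shows "closed (rational_points G \<inter> C)"
proof -
  define J where "J = {h \<in> gen_algebra base_field GL_coords. \<forall>A\<in>G. h A = 0}"
  have "\<forall>h\<in>J. \<exists>h'. continuous_on GL h' \<and> (\<forall>A. h (map_matrix to_ac A) = to_ac (h' A))"
    unfolding J_def using regular_base_continuous by blast
  then obtain r where r: "\<And>h. h \<in> J \<Longrightarrow> continuous_on GL (r h)"
    "\<And>h A. h \<in> J \<Longrightarrow> h (map_matrix to_ac A) = to_ac (r h A)" by metis
  obtain Es where Es: "Es \<subseteq> gen_algebra UNIV GL_coords" "G = {A \<in> GL. \<forall>f\<in>Es. f A = 0}"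
    using G unfolding zariski_closed_def by blast
  have "A \<in> rational_points G \<longleftrightarrow> (\<forall>h\<in>J. r h A = 0)" if A: "A \<in> C" for A
  proof
    assume A: "A \<in> rational_points G"
    show "\<forall>h\<in>J. r h A = 0"
    proof
      fix h assume h: "h \<in> J"
      then have "h (map_matrix to_ac A) = 0" using A by (simp add: rational_points_def J_def)
      then show "r h A = 0" using r(2)[OF h] by simp
    qed
  next
    assume zero: "\<forall>h\<in>J. r h A = 0"
    have GL: "map_matrix to_ac A \<in> GL"
      using A C by (auto simp: GL_def invertible_map_matrix_to_ac)
    \<comment> \<open>Equations of \<open>G\<close> have coefficients in the closure. Definedness
      over F writes each as a combination of equations over F, to which \<open>zero\<close>
      applies.\<close>
    have "f (map_matrix to_ac A) = 0" if f: "f \<in> Es" for f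
    proof -
      have "f \<in> gen_algebra UNIV GL_coords" "\<forall>A\<in>G. f A = 0" using f Es by auto
      then obtain T c where "T \<subseteq> J" "\<forall>A\<in>GL. f A = (\<Sum>h\<in>T. c h A * h A)"
        using G(2)[unfolded defined_over_base_def, folded J_def, rule_format, of f] by auto
      moreover have "h (map_matrix to_ac A) = 0" if "h \<in> J" for h
        using r(2)[OF that, of A] zero that by simp
      ultimately show ?thesis using GL by (auto intro!: sum.neutral)
    qed
    then show "A \<in> rational_points G" using Es GL by (simp add: rational_points_def)
  qed
  then have "rational_points G \<inter> C = C \<inter> (\<Inter>h\<in>J. C \<inter> r h -` {0})" by auto
  moreover have "closed (C \<inter> r h -` {0})" if "h \<in> J" for h
    using continuous_on_subset[OF r(1)[OF that] C(2)] C(1) by (rule continuous_closed_preimage) simp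
  then have "closed (C \<inter> (\<Inter>h\<in>J. C \<inter> r h -` {0}))"
    by (intro closed_Int[OF C(1)] closed_INT) blast
  ultimately show ?thesis by simp
qed

section \<open>Descent of the groups of a cocharacter to points over F\<close>

context local_idempotents
begin

text \<open>The algebraic groups live over the closure and the dynamics over F; the same idempotents
  describe both.\<close>

sublocale ac: idempotents I "\<lambda>i. map_matrix to_ac (E i)"
proof
  show "map_matrix to_ac (E i) ** map_matrix to_ac (E j) = (if i = j then map_matrix to_ac (E i) else 0)"
    if "i \<in> I" "j \<in> I" for i j
    using orthogonal[OF that] by (simp add: vec_eq_iff flip: map_matrix_to_ac_mult)
  show "(\<Sum>i\<in>I. map_matrix to_ac (E i)) = mat 1"
    using sum_E by (simp add: map_matrix_to_ac_mat flip: map_matrix_to_ac_sum)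
qed (rule finite_I)

lemma ac_block: "ac.block i j (map_matrix to_ac A) = map_matrix to_ac (block i j A)"
  by (simp add: ac.block_def block_def map_matrix_to_ac_mult)

lemma map_matrix_to_ac_eq_0_iff: "map_matrix to_ac A = 0 \<longleftrightarrow> A = (0 :: 'f ^ 'n ^ 'n)"
  by (simp add: vec_eq_iff)

lemma ac_upper: "ac.upper k (map_matrix to_ac A) \<longleftrightarrow> upper k A"
  by (simp add: ac.upper_def upper_def ac_block map_matrix_to_ac_eq_0_iff)

lemma ac_part0: "ac.part0 k (map_matrix to_ac A) = map_matrix to_ac (part0 k A)"
  unfolding ac.part0_def part0_def ac_block map_matrix_to_ac_sum map_matrix_to_ac_mult map_matrix_to_ac_mat
  by (intro sum.cong refl arg_cong2[of _ _ _ _ "(**)"] arg_cong[of _ _ mat]) auto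

lemma ac_diag: "ac.diag k (to_ac t) = map_matrix to_ac (diag k t)"
  by (simp add: ac.diag_def diag_def map_matrix_to_ac_sum map_matrix_to_ac_mult map_matrix_to_ac_mat to_ac_power_int)

lemma ac_twist: "ac.twist (to_ac t) k (map_matrix to_ac A) = map_matrix to_ac (twist t k A)"
  by (simp add: ac.twist_def twist_def ac_diag map_matrix_to_ac_mult)

context
  fixes G :: "('f alg_closure ^ 'n ^ 'n) set" and \<mu> :: "'f alg_closure \<Rightarrow> 'f alg_closure ^ 'n ^ 'n"
    and k :: "'i \<Rightarrow> int"
  assumes group: "matrix_group G" and closed: "zariski_closed G"
    and \<mu>: "\<And>t. t \<noteq> 0 \<Longrightarrow> \<mu> t = ac.diag k t" "\<And>t. t \<noteq> 0 \<Longrightarrow> \<mu> t \<in> G"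
begin

lemma infinite_alg_closure: "infinite (UNIV :: 'f alg_closure set)"
  using infinite_UNIV_local_field finite_subset[OF subset_UNIV, of "range to_ac"] finite_imageD[OF _ inj_to_ac]
  by blast

lemmas limit_facts = infinite_alg_closure group closed \<mu>

text \<open>The inverse cocharacter has the negated weights, so all results on limits also apply to
  the opposite groups.\<close>

lemma inverse_cochar_facts:
  "t \<noteq> 0 \<Longrightarrow> inverse_cochar \<mu> t = ac.diag (\<lambda>i. - k i) t"
  "t \<noteq> 0 \<Longrightarrow> inverse_cochar \<mu> t \<in> G"
proof -
  assume t: "t \<noteq> 0"
  show "inverse_cochar \<mu> t = ac.diag (\<lambda>i. - k i) t"
    using t by (simp add: inverse_cochar_def \<mu>(1) ac.matrix_inv_diag)
  show "inverse_cochar \<mu> t \<in> G"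
    unfolding inverse_cochar_def by (rule matrix_group_closed(3)[OF group \<mu>(2)[OF t]])
qed

lemmas inverse_limit_facts = infinite_alg_closure group closed inverse_cochar_facts

lemma rational_twist:
  assumes "A \<in> rational_points G" "t \<noteq> 0"
  shows "twist t k A \<in> rational_points G" "twist t (\<lambda>i. - k i) A \<in> rational_points G"
  using assms ac.twist_closed[OF limit_facts, of "to_ac t" "map_matrix to_ac A"]
    ac.twist_closed[OF inverse_limit_facts, of "to_ac t" "map_matrix to_ac A"]
  by (simp_all add: rational_points_def ac_twist)

lemma rational_part0:
  assumes "A \<in> rational_points G" "upper k A \<or> upper (\<lambda>i. - k i) A"
  shows "part0 k A \<in> rational_points G"
  using assms ac.part0_closed[OF limit_facts, of "map_matrix to_ac A"]
    ac.part0_closed[OF inverse_limit_facts, of "map_matrix to_ac A"]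
  by (auto simp: rational_points_def ac_part0 ac_upper ac.part0_minus)

lemma rational_U_group: "rational_points (U_group G \<mu>) = rational_points G \<inter> upper_unipotent k"
  "rational_points (U_group G (inverse_cochar \<mu>)) = rational_points G \<inter> upper_unipotent (\<lambda>i. - k i)"
proof -
  have one: "map_matrix to_ac A = mat 1 \<longleftrightarrow> A = mat 1" for A :: "'f ^ 'n ^ 'n"
    using map_matrix_to_ac_eq_iff[of A "mat 1"] by (simp add: map_matrix_to_ac_mat)
  have "U_group G \<mu> = {g \<in> G. ac.upper k g \<and> ac.part0 k g = mat 1}"
    by (rule ac.U_group_eq[OF limit_facts])
  then show "rational_points (U_group G \<mu>) = rational_points G \<inter> upper_unipotent k"
    by (auto simp: rational_points_def upper_unipotent_def ac_upper ac_part0 one)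
  have "U_group G (inverse_cochar \<mu>) = {g \<in> G. ac.upper (\<lambda>i. - k i) g \<and> ac.part0 (\<lambda>i. - k i) g = mat 1}"
    by (rule ac.U_group_eq[OF inverse_limit_facts])
  then show "rational_points (U_group G (inverse_cochar \<mu>)) = rational_points G \<inter> upper_unipotent (\<lambda>i. - k i)"
    by (auto simp: rational_points_def upper_unipotent_def ac_upper ac_part0 one)
qed

lemma rational_Z_group: "rational_points (Z_group G \<mu>) = rational_points G \<inter> centralizing k"
proof -
  have "P_group G \<mu> = {g \<in> G. ac.upper k g}"
    by (rule ac.P_group_eq[OF limit_facts])
  moreover have "P_group G (inverse_cochar \<mu>) = {g \<in> G. ac.upper (\<lambda>i. - k i) g}"
    by (rule ac.P_group_eq[OF inverse_limit_facts])
  ultimately show ?thesis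
    by (auto simp: Z_group_def rational_points_def centralizing_def ac_upper)
qed

end

end

theorem theorem3:
  fixes G S :: "('f::nonarch_local_field alg_closure ^ 'n ^ 'n) set"
    and N :: "('f ^ 'n ^ 'n) set"
  assumes "quasi_reductive G"
    and "maximal_split_torus G S"
    and "openin (top_of_set (rational_points G)) N"
    and "mat 1 \<in> N"
  shows "\<exists>K. compact_open_subgroup (rational_points G) K \<and> K \<subseteq> N \<and> iwahori_decomposition G S K"
proof -
  have group: "matrix_group G" and closed: "zariski_closed G" "defined_over_base G"
    using assms(1) by (auto simp: quasi_reductive_def linear_algebraic_group_def)
  have S: "split_torus S" "S \<subseteq> G" using assms(2) by (auto simp: maximal_split_torus_def)
  obtain I :: "((nat \<Rightarrow> 'f alg_closure) \<Rightarrow> 'f alg_closure) set" and E :: "_ \<Rightarrow> 'f ^ 'n ^ 'n"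
    where IE: "idempotents I E" and weights: "\<And>\<mu>. cocharacter S \<mu> \<Longrightarrow>
      \<exists>k. \<forall>t. t \<noteq> 0 \<longrightarrow> \<mu> t = (\<Sum>i\<in>I. mat (t powi k i) ** map_matrix to_ac (E i))"
    using that by (rule split_torus_weights[OF S(1)])
  interpret idempotents I E by (rule IE)
  interpret local_idempotents I E ..
  \<comment> \<open>All weight functions that represent some cocharacter of \<open>S\<close>. The
    set may be infinite, since only their sign patterns are finite in number.\<close>
  define \<K> where "\<K> = {k. \<exists>\<mu>. cocharacter S \<mu> \<and> (\<forall>t. t \<noteq> 0 \<longrightarrow> \<mu> t = ac.diag k t)}"
  have \<mu>G: "\<mu> t \<in> G" if "cocharacter S \<mu>" "t \<noteq> 0" for \<mu> t
    using that S(2) by (auto simp: cocharacter_def)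
  define \<Gamma> where "\<Gamma> = rational_points G"
  have \<Gamma>: "matrix_group \<Gamma>" unfolding \<Gamma>_def by (rule matrix_group_rational_points[OF group])
  obtain p :: 'f where p: "0 < av p" "av p < 1" by (rule uniformizer_exists) blast
  then have p0: "p \<noteq> 0" by simp
  \<comment> \<open>Any radius strictly between 0 and 1 would serve.\<close>
  define e where "e = av p"
  have e: "0 < e" "e < 1" using p by (simp_all add: e_def)
  have cpt: "compact (\<Gamma> \<inter> congruence d)" if "0 < d" "d < 1" for d
  proof -
    have "congruence d \<subseteq> GL" using that congruence_invertible[of _ d] by (auto simp: GL_def)
    then have "closed (\<Gamma> \<inter> congruence d)"
      unfolding \<Gamma>_def by (intro rational_points_closed_in_GL closed closed_congruence)
    then have "compact (\<Gamma> \<inter> congruence d \<inter> congruence d)"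
      using that by (intro closed_Int_compact compact_congruence) auto
    then show ?thesis by (simp add: Int_assoc)
  qed
  have stable: "twist p k A \<in> \<Gamma>" "twist p (\<lambda>i. - k i) A \<in> \<Gamma>" if "k \<in> \<K>" "A \<in> \<Gamma>" for k A
  proof -
    obtain \<mu> where "cocharacter S \<mu>" "\<And>t. t \<noteq> 0 \<Longrightarrow> \<mu> t = ac.diag k t" using \<open>k \<in> \<K>\<close> unfolding \<K>_def by blast
    from rational_twist[OF group closed(1) this(2) \<mu>G[OF this(1)] \<open>A \<in> \<Gamma>\<close>[unfolded \<Gamma>_def] p0]
    show "twist p k A \<in> \<Gamma>" "twist p (\<lambda>i. - k i) A \<in> \<Gamma>" by (simp_all add: \<Gamma>_def)
  qed
  have lim: "part0 k A \<in> \<Gamma>" if "k \<in> \<K>" "A \<in> \<Gamma>" "upper k A \<or> upper (\<lambda>i. - k i) A" for k A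
  proof -
    obtain \<mu> where "cocharacter S \<mu>" "\<And>t. t \<noteq> 0 \<Longrightarrow> \<mu> t = ac.diag k t" using \<open>k \<in> \<K>\<close> unfolding \<K>_def by blast
    from rational_part0[OF group closed(1) this(2) \<mu>G[OF this(1)] that(2)[unfolded \<Gamma>_def] that(3)]
    show ?thesis by (simp add: \<Gamma>_def)
  qed
  obtain c where c: "0 < c" "c \<le> e"
    and bij: "\<And>d k. 0 < d \<Longrightarrow> d \<le> c \<Longrightarrow> k \<in> \<K> \<Longrightarrow> bij_betw (\<lambda>(u, m, u'). u ** m ** u')
      ((\<Gamma> \<inter> congruence d \<inter> upper_unipotent k) \<times> (\<Gamma> \<inter> congruence d \<inter> centralizing k) \<times>
       (\<Gamma> \<inter> congruence d \<inter> upper_unipotent (\<lambda>i. - k i))) (\<Gamma> \<inter> congruence d)"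
    by (rule iwahori_bij_exists[OF \<Gamma> e cpt[OF e] p0 p(2) stable lim lim]) blast+
  obtain T where T: "open T" "N = \<Gamma> \<inter> T" using assms(3) by (auto simp: openin_open \<Gamma>_def)
  then obtain b where b: "b > 0" "congruence b \<subseteq> T"
    using congruence_subset_nhd[of T] assms(4) by auto
  \<comment> \<open>\<open>b\<close> places \<open>K\<close> inside \<open>N\<close> and
    \<open>c\<close> provides the factorization.\<close>
  define d where "d = min b c"
  have d: "0 < d" "d \<le> c" "d < 1" "d \<le> b" using b c e by (auto simp: d_def)
  define K where "K = \<Gamma> \<inter> congruence d"
  have "compact_open_subgroup (rational_points G) K"
    unfolding compact_open_subgroup_def K_def
  proof (intro conjI)
    show "matrix_group (\<Gamma> \<inter> congruence d)"
      using \<Gamma> matrix_group_congruence[of d] d unfolding matrix_group_def by auto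
    show "openin (top_of_set (rational_points G)) (\<Gamma> \<inter> congruence d)"
      unfolding \<Gamma>_def using open_congruence[OF d(1)] by (auto simp: openin_open)
  qed (use cpt d in \<open>auto simp: \<Gamma>_def\<close>)
  moreover have "K \<subseteq> N"
    using congruence_mono[OF d(4)] b T by (auto simp: K_def)
  moreover have "iwahori_decomposition G S K"
    unfolding iwahori_decomposition_def opposite_pseudo_parabolics_def
  proof clarify
    fix \<mu> assume \<mu>: "cocharacter S \<mu>"
    then obtain k where k: "\<And>t. t \<noteq> 0 \<Longrightarrow> \<mu> t = ac.diag k t"
      using weights unfolding ac.diag_def by blast
    then have "k \<in> \<K>" using \<mu> unfolding \<K>_def by blast
    have K: "K \<inter> (rational_points G \<inter> Y) = \<Gamma> \<inter> congruence d \<inter> Y" for Y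
      by (auto simp: K_def \<Gamma>_def)
    show "bij_betw (\<lambda>(u, m, u'). u ** m ** u')
        ((K \<inter> rational_points (U_group G \<mu>)) \<times> (K \<inter> rational_points (Z_group G \<mu>)) \<times>
         (K \<inter> rational_points (U_group G (inverse_cochar \<mu>)))) K"
    proof -
      have "rational_points (U_group G \<mu>) = rational_points G \<inter> upper_unipotent k"
        "rational_points (U_group G (inverse_cochar \<mu>)) = rational_points G \<inter> upper_unipotent (\<lambda>i. - k i)"
        "rational_points (Z_group G \<mu>) = rational_points G \<inter> centralizing k"
        by (rule rational_U_group[OF group closed(1) k \<mu>G[OF \<mu>]] rational_Z_group[OF group closed(1) k \<mu>G[OF \<mu>]];
            assumption)+
      then show ?thesis using bij[OF d(1,2) \<open>k \<in> \<K>\<close>] by (simp add: K) (simp add: K_def)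
    qed
  qed
  ultimately show ?thesis by blast
qed

end
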